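(* Let $d\ge2$ and let $\lambda\in\mathbb{R}$ satisfy $2d-4<|\lambda|<2d$. Let $D_0,D$ be open convex bounded domains in $\mathbb{R}^d$ with $D_0\cap\mathbb{Z}^d\neq\emptyset$, $D\cap\mathbb{Z}^d\ne\emptyset$ and $\operatorname{dist}(D,D_0)>0$. Let $v_0,v:\mathbb{Z}^d\to\mathbb{C}$ satisfy $\operatorname{supp}v_0\subset D_0$, $\operatorname{supp}v\subset D$, $v_0\not\equiv0$, and let $A$ and $A_1$ be the Born-approximation scattering amplitudes at $\lambda$ of the potentials $v$ and $v+v_0$, respectively. Let $\mathcal{N}\subseteq\Gamma(\lambda)\times\mathbb{S}^{d-1}$ be an open nonempty neighbourhood of some fixed pair $(k,\omega)\in\Gamma(\lambda)\times\mathbb{S}^{d-1}$. Then the intensities $|A|^2=|A(k,\omega)|^2$ and $|A_1|^2=|A_1(k,\omega)|^2$ given on $\mathcal{N}$ uniquely determine $v$, assuming that $v_0$ is known a priori. That is, with $D_0,D,v_0$ fixed, if $v,w:\mathbb{Z}^d\to\mathbb{C}$ are both supported in $D$, the squared moduli of the Born-approximation scattering amplitudes of $v$ and of $w$ at $\lambda$ coincide on $\mathcal{N}$, and those of $v+v_0$ and of $w+v_0$ coincide on $\mathcal{N}$, then $v=w$.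
   Context: $T^d=\mathbb{R}^d/2\pi\mathbb{Z}^d$, $\phi(k)=2\sum_{i=1}^d\cos k_i$, $\Gamma(\lambda)=\{k\in T^d:\phi(k)=\lambda\}$. For $2d-4<|\lambda|<2d$ the surface $\Gamma(\lambda)$ is smooth and strictly convex with non-zero principal curvatures, and for $\omega\in\mathbb{S}^{d-1}$, $\kappa(\omega,\lambda)$ denotes the unique point of $\Gamma(\lambda)$ with $\nabla\phi(\kappa)/|\nabla\phi(\kappa)|=\omega$. $K(\omega,\lambda)$ is the total curvature (product of principal curvatures) of $\Gamma(\lambda)$ at $\kappa(\omega,\lambda)$, and $\sigma=d-1$. Discrete Fourier transform: $\hat v(p)=(2\pi)^{-d/2}\sum_{x\in\mathbb{Z}^d}v(x)e^{-ip\cdot x}$, $p\in T^d$. For bounded sets: $\operatorname{dist}(D,D_0)=\inf_{x\in D,\,y\in D_0}|x-y|$. The discrete Schrödinger equation is $\Delta\psi+v\psi-\lambda\psi=0$ on $\mathbb{Z}^d$, with $\Delta\psi(x)=\sum_{|x'-x|=1}\psi(x')$. The scattering amplitude of a compactly supported potential $v$ in the Born approximation (for small $v$) is the function $$A(k,\omega)=-\frac{\sqrt{2\pi}\,\hat v\big(\kappa(-\omega,\lambda)-k\big)\,e^{-i(\sigma+2)\pi/4}}{\sqrt{|K(\omega,\lambda)|}\,|\nabla\phi(\kappa(\omega,\lambda))|},\qquad k\in\Gamma(\lambda),\ \omega\in\mathbb{S}^{d-1}.$$ In the statement, scattering amplitudes mean these functions. *)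

theory Defs
  imports "HOL-Analysis.Analysis"
begin

section \<open>The lattice and the torus\<close>

text \<open>The dimension \<open>d\<close> is \<open>CARD('n)\<close>, and \<open>\<int>\<^sup>d\<close> is the type \<open>int ^ 'n\<close>.\<close>

definition lattice_point :: "int ^ 'n \<Rightarrow> real ^ 'n" where
  "lattice_point x = (\<chi> i. of_int (x $ i))"

lemma lattice_point_nth [simp]: "lattice_point x $ i = of_int (x $ i)"
  by (simp add: lattice_point_def)

lemma lattice_point_0 [simp]: "lattice_point 0 = 0"
  by (simp add: vec_eq_iff)

lemma lattice_point_add: "lattice_point (x + y) = lattice_point x + lattice_point y"
  by (simp add: vec_eq_iff)

lemma lattice_point_minus: "lattice_point (- x) = - lattice_point x"
  by (simp add: vec_eq_iff)

definition torus_rel :: "real ^ 'n \<Rightarrow> real ^ 'n \<Rightarrow> bool" where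
  "torus_rel p q \<longleftrightarrow> (\<exists>z :: int ^ 'n. p = q + (2 * pi) *\<^sub>R lattice_point z)"

lemma equivp_torus_rel: "equivp (torus_rel :: real ^ 'n \<Rightarrow> real ^ 'n \<Rightarrow> bool)"
proof (rule equivpI)
  show "reflp (torus_rel :: real ^ 'n \<Rightarrow> _)"
    by (auto intro!: reflpI exI[of _ 0] simp: torus_rel_def)
  show "symp (torus_rel :: real ^ 'n \<Rightarrow> _)"
  proof (rule sympI)
    fix p q :: "real ^ 'n" assume "torus_rel p q"
    then obtain z where "p = q + (2 * pi) *\<^sub>R lattice_point z" by (auto simp: torus_rel_def)
    then have "q = p + (2 * pi) *\<^sub>R lattice_point (- z)" by (simp add: lattice_point_minus)
    then show "torus_rel q p" unfolding torus_rel_def by blast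
  qed
  show "transp (torus_rel :: real ^ 'n \<Rightarrow> _)"
  proof (rule transpI)
    fix p q r :: "real ^ 'n" assume "torus_rel p q" "torus_rel q r"
    then obtain z w where "p = q + (2 * pi) *\<^sub>R lattice_point z"
      "q = r + (2 * pi) *\<^sub>R lattice_point w" by (auto simp: torus_rel_def)
    then have "p = r + (2 * pi) *\<^sub>R lattice_point (w + z)"
      by (simp add: lattice_point_add scaleR_add_right)
    then show "torus_rel p r" unfolding torus_rel_def by blast
  qed
qed

quotient_type (overloaded) 'n torus = "real ^ 'n" / torus_rel
  by (rule equivp_torus_rel)

instantiation torus :: (finite) topological_space
begin

definition open_torus :: "'a torus set \<Rightarrow> bool" where
  "open_torus U \<longleftrightarrow> open (abs_torus -` U)"

instance
proof
  show "open (UNIV :: 'a torus set)" by (simp add: open_torus_def)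
  show "open (S \<inter> T)" if "open S" "open T" for S T :: "'a torus set"
    using that by (auto simp: open_torus_def vimage_Int)
  show "open (\<Union> K)" if "\<forall>S\<in>K. open S" for K :: "'a torus set set"
    using that by (auto simp: open_torus_def vimage_Union)
qed

end

instantiation torus :: (finite) ab_group_add
begin

lift_definition zero_torus :: "'a torus" is "0" .

lift_definition plus_torus :: "'a torus \<Rightarrow> 'a torus \<Rightarrow> 'a torus" is "(+)"
proof -
  fix p p' q q' :: "real ^ 'a" assume "torus_rel p p'" "torus_rel q q'"
  then obtain z w where "p = p' + (2 * pi) *\<^sub>R lattice_point z"
    "q = q' + (2 * pi) *\<^sub>R lattice_point w" by (auto simp: torus_rel_def)
  then have "p + q = (p' + q') + (2 * pi) *\<^sub>R lattice_point (z + w)"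
    by (simp add: lattice_point_add scaleR_add_right)
  then show "torus_rel (p + q) (p' + q')" unfolding torus_rel_def by blast
qed

lift_definition uminus_torus :: "'a torus \<Rightarrow> 'a torus" is "uminus"
proof -
  fix p p' :: "real ^ 'a" assume "torus_rel p p'"
  then obtain z where "p = p' + (2 * pi) *\<^sub>R lattice_point z" by (auto simp: torus_rel_def)
  then have "- p = - p' + (2 * pi) *\<^sub>R lattice_point (- z)" by (simp add: lattice_point_minus)
  then show "torus_rel (- p) (- p')" unfolding torus_rel_def by blast
qed

definition minus_torus :: "'a torus \<Rightarrow> 'a torus \<Rightarrow> 'a torus" where
  "minus_torus p q = p + - q"

instance
proof
  note refl = equivp_reflp[OF equivp_torus_rel]
  fix p q r :: "'a torus"
  show "p + q + r = p + (q + r)" by transfer (simp add: add.assoc refl)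
  show "p + q = q + p" by transfer (simp add: add.commute refl)
  show "0 + p = p" by transfer (simp add: refl)
  show "- p + p = 0" by transfer (simp add: refl)
  show "p - q = p + - q" by (rule minus_torus_def)
qed

end

section \<open>The discrete Fourier transform\<close>

lift_definition fourier :: "(int ^ 'n \<Rightarrow> complex) \<Rightarrow> 'n::finite torus \<Rightarrow> complex" is
  "\<lambda>v p. of_real ((2 * pi) powr (- (real CARD('n) / 2))) *
     (\<Sum>\<^sub>\<infinity>x. v x * exp (- \<i> * of_real (p \<bullet> lattice_point x)))"
proof -
  fix v :: "int ^ 'n \<Rightarrow> complex" and p q :: "real ^ 'n"
  assume "torus_rel p q"
  then obtain z where z: "p = q + (2 * pi) *\<^sub>R lattice_point z" by (auto simp: torus_rel_def)
  have "exp (- \<i> * of_real (p \<bullet> lattice_point x)) = exp (- \<i> * of_real (q \<bullet> lattice_point x))"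
    for x :: "int ^ 'n"
  proof -
    define m where "m = (\<Sum>i\<in>UNIV. z $ i * x $ i)"
    have "lattice_point z \<bullet> lattice_point x = of_int m"
      by (simp add: inner_vec_def m_def)
    then have "- \<i> * of_real (p \<bullet> lattice_point x) =
        - \<i> * of_real (q \<bullet> lattice_point x) + of_real (of_int (2 * (- m)) * pi) * \<i>"
      by (simp add: z inner_add_left algebra_simps)
    then show ?thesis unfolding exp_eq by blast
  qed
  then show "of_real ((2 * pi) powr (- (real CARD('n) / 2))) *
      (\<Sum>\<^sub>\<infinity>x. v x * exp (- \<i> * of_real (p \<bullet> lattice_point x))) =
    of_real ((2 * pi) powr (- (real CARD('n) / 2))) *
      (\<Sum>\<^sub>\<infinity>x. v x * exp (- \<i> * of_real (q \<bullet> lattice_point x)))"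
    by simp
qed

section \<open>Differential geometry of level sets in Euclidean space\<close>

definition gradient :: "(real ^ 'n \<Rightarrow> real) \<Rightarrow> real ^ 'n \<Rightarrow> real ^ 'n" where
  "gradient f x = (\<chi> i. frechet_derivative f (at x) (axis i 1))"

definition unit_normal :: "(real ^ 'n \<Rightarrow> real) \<Rightarrow> real ^ 'n \<Rightarrow> real ^ 'n" where
  "unit_normal f x = gradient f x /\<^sub>R norm (gradient f x)"

definition level_tangent_space :: "(real ^ 'n \<Rightarrow> real) \<Rightarrow> real ^ 'n \<Rightarrow> (real ^ 'n) set" where
  "level_tangent_space f x = {u. gradient f x \<bullet> u = 0}"

text \<open>The Weingarten map at \<open>x\<close> of the level set of \<open>f\<close> through \<open>x\<close> is the restriction of this
  map to the tangent space. The opposite sign convention would change the total curvature at most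
  by a sign.\<close>

definition weingarten :: "(real ^ 'n \<Rightarrow> real) \<Rightarrow> real ^ 'n \<Rightarrow> real ^ 'n \<Rightarrow> real ^ 'n" where
  "weingarten f x = frechet_derivative (unit_normal f) (at x)"

definition principal_space :: "(real ^ 'n \<Rightarrow> real) \<Rightarrow> real ^ 'n \<Rightarrow> real \<Rightarrow> (real ^ 'n) set" where
  "principal_space f x c = {u \<in> level_tangent_space f x. weingarten f x u = c *\<^sub>R u}"

definition principal_curvatures :: "(real ^ 'n \<Rightarrow> real) \<Rightarrow> real ^ 'n \<Rightarrow> real set" where
  "principal_curvatures f x = {c. \<exists>u\<in>principal_space f x c. u \<noteq> 0}"

text \<open>Each principal curvature is counted with its multiplicity; the Weingarten map is self-adjoint,
  so this is the dimension of the eigenspace.\<close>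

definition total_curvature :: "(real ^ 'n \<Rightarrow> real) \<Rightarrow> real ^ 'n \<Rightarrow> real" where
  "total_curvature f x = (\<Prod>c\<in>principal_curvatures f x. c ^ dim (principal_space f x c))"

section \<open>The level surfaces of the symbol of the discrete Laplacian\<close>

definition phi_lift :: "real ^ 'n \<Rightarrow> real" where
  "phi_lift k = 2 * (\<Sum>i\<in>UNIV. cos (k $ i))"

lemma phi_lift_shift: "phi_lift (k + (2 * pi) *\<^sub>R lattice_point z) = phi_lift k"
proof -
  have "cos (k $ i + 2 * pi * of_int (z $ i)) = cos (k $ i)" for i
    by (simp add: cos_add)
  then show ?thesis by (simp add: phi_lift_def)
qed

lemma frechet_derivative_periodic:
  fixes f :: "'a::real_normed_vector \<Rightarrow> 'b::real_normed_vector"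
  assumes "\<And>x. f (x + a) = f x"
  shows "frechet_derivative f (at (x + a)) = frechet_derivative f (at x)"
proof -
  have "(f has_derivative D) (at (x + a)) \<longleftrightarrow> (f has_derivative D) (at x)" for D
  proof
    assume "(f has_derivative D) (at (x + a))"
    moreover have "((\<lambda>y. y + a) has_derivative (\<lambda>h. h)) (at x)"
      by (auto intro!: derivative_eq_intros)
    ultimately have "((\<lambda>y. f (y + a)) has_derivative D) (at x)"
      using has_derivative_compose by fastforce
    then show "(f has_derivative D) (at x)" by (simp add: assms)
  next
    assume D: "(f has_derivative D) (at x)"
    have "f (y - a) = f y" for y using assms[of "y - a"] by simp
    moreover have "((\<lambda>y. f (y - a)) has_derivative D) (at (x + a))"
      by (rule has_derivative_compose[where f = "\<lambda>y. y - a" and f' = "\<lambda>h. h", simplified])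
        (auto intro!: derivative_eq_intros D)
    ultimately show "(f has_derivative D) (at (x + a))" by simp
  qed
  then show ?thesis by (simp add: frechet_derivative_def)
qed

lemma gradient_phi_lift_shift:
  "gradient phi_lift (k + (2 * pi) *\<^sub>R lattice_point z) = gradient phi_lift k"
  unfolding gradient_def by (subst frechet_derivative_periodic) (auto simp: phi_lift_shift)

lemma total_curvature_phi_lift_shift:
  "total_curvature phi_lift (k + (2 * pi) *\<^sub>R lattice_point z) = total_curvature phi_lift k"
proof -
  have "weingarten phi_lift (k + (2 * pi) *\<^sub>R lattice_point z) = weingarten phi_lift k"
    unfolding weingarten_def
    by (rule frechet_derivative_periodic) (simp add: unit_normal_def gradient_phi_lift_shift)
  then show ?thesis
    by (simp add: total_curvature_def principal_curvatures_def principal_space_def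
        level_tangent_space_def gradient_phi_lift_shift)
qed

lift_definition phi :: "'n::finite torus \<Rightarrow> real" is phi_lift
  by (auto simp: torus_rel_def phi_lift_shift)

lift_definition grad_phi :: "'n::finite torus \<Rightarrow> real ^ 'n" is "gradient phi_lift"
  by (auto simp: torus_rel_def gradient_phi_lift_shift)

lift_definition curvature_phi :: "'n::finite torus \<Rightarrow> real" is "total_curvature phi_lift"
  by (auto simp: torus_rel_def total_curvature_phi_lift_shift)

definition Gamma_surface :: "real \<Rightarrow> 'n::finite torus set" where
  "Gamma_surface l = {k. phi k = l}"

definition kappa :: "real ^ 'n \<Rightarrow> real \<Rightarrow> 'n::finite torus" where
  "kappa \<omega> l = (THE k. k \<in> Gamma_surface l \<and> grad_phi k /\<^sub>R norm (grad_phi k) = \<omega>)"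

definition K_curvature :: "real ^ 'n \<Rightarrow> real \<Rightarrow> real" where
  "K_curvature \<omega> l = curvature_phi (kappa \<omega> l)"

section \<open>The scattering amplitude in the Born approximation\<close>

definition born_amplitude ::
  "real \<Rightarrow> (int ^ 'n \<Rightarrow> complex) \<Rightarrow> 'n::finite torus \<Rightarrow> real ^ 'n \<Rightarrow> complex" where
  "born_amplitude l v k \<omega> =
     (let \<sigma> = real CARD('n) - 1 in
      - (of_real (sqrt (2 * pi)) * fourier v (kappa (- \<omega>) l - k)
           * exp (- \<i> * of_real ((\<sigma> + 2) * pi / 4)))
        / of_real (sqrt \<bar>K_curvature \<omega> l\<bar> * norm (grad_phi (kappa \<omega> l))))"

end

theory Submission
  imports Defs
begin

text \<open>
  The intensities determine \<open>v\<close> because adding the known \<open>v\<^sub>0\<close> turns them into holograms. For a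
  fixed \<open>\<omega>\<close> the amplitude is a nonzero constant times \<open>fourier v (\<kappa>(-\<omega>) - k)\<close>, so subtracting the
  intensity of \<open>v\<close> from that of \<open>v + v\<^sub>0\<close> leaves, up to terms not depending on \<open>v\<close>, the interference
  term \<open>2 Re (F cnj G)\<close>, where \<open>F\<close> and \<open>G\<close> are the Fourier transforms of \<open>v\<close> and \<open>v\<^sub>0\<close>. For two
  potentials with the same data, their difference \<open>u\<close> satisfies \<open>Re (F cnj G) = 0\<close>, now with \<open>F\<close> the
  transform of \<open>u\<close>, at every momentum \<open>q - k\<close> that the data reach.

  Three facts turn this into \<open>u = 0\<close>.

  \<^item> The reached momenta contain an open set (\<open>level_difference_interior\<close>): where the normals of the
    surface at \<open>k\<close> and at \<open>q\<close> are linearly independent, \<open>(k, p) \<mapsto> (\<phi>(k), \<phi>(k + p), p)\<close> is a submersion.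
    Independence can be arranged by moving \<open>\<omega>\<close> slightly, since \<open>d \<ge> 2\<close>.

  \<^item> \<open>F cnj G\<close> and its conjugate are exponential sums with frequencies in \<open>D - D\<^sub>0\<close> and \<open>D\<^sub>0 - D\<close>.
    These sets are disjoint because \<open>D\<close> and \<open>D\<^sub>0\<close> are convex and disjoint, and distinct characters are
    linearly independent on every nonempty open set. So \<open>F cnj G = 0\<close> everywhere, and since
    exponential sums have no zero divisors, \<open>F = 0\<close> (\<open>interference_determines\<close>).

  \<^item> The amplitude really carries the transform: \<open>\<kappa>\<close> is well defined and neither the gradient nor the
    total curvature vanishes on the surface. All of this is a statement about points of a product of
    circles, with coordinates \<open>c i = \<plusminus>cos k\<^sub>i\<close> (the sign being that of \<open>\<lambda>\<close>) and \<open>s i = sin k\<^sub>i\<close>,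
    such that \<open>\<Sum> c > d - 2\<close>. This bound lets at most one \<open>c i\<close> be nonpositive. It makes the second
    fundamental form definite (\<open>form_definite\<close>), and it reduces the Gauss map to a convex function
    of one variable (\<open>gauss_unique\<close>, \<open>gauss_exists\<close>).
\<close>

section \<open>Exponential sums on open sets\<close>

definition character :: "'a::euclidean_space \<Rightarrow> 'a \<Rightarrow> complex" where
  "character x p = exp (- \<i> * of_real (p \<bullet> x))"

lemma character_add: "character x (p + q) = character x p * character x q"
  by (simp add: character_def inner_add_left distrib_left flip: exp_add)

lemma character_diff: "character (x - y) p = character x p * cnj (character y p)"
  by (simp add: character_def inner_diff_right exp_cnj algebra_simps flip: exp_add)

lemma character_nonzero [simp]: "character x p \<noteq> 0"
  by (simp add: character_def)

text \<open>The translations \<open>h\<close> used to isolate one character from another must be short enough to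
  stay inside a given open set; a small multiple of \<open>x - y\<close> works.\<close>

lemma character_separates:
  assumes "x \<noteq> y" "e > 0"
  obtains h where "norm h < e" "character x h \<noteq> character y h"
proof -
  define z where "z = x - y"
  have z: "norm z > 0" using assms by (simp add: z_def)
  define t where "t = min (e / (2 * norm z)) (1 / (norm z)\<^sup>2)"
  have t: "t > 0" "t * norm z < e" "t * (norm z)\<^sup>2 \<le> 1"
  proof -
    show "t > 0" using z assms by (simp add: t_def)
    have "t * norm z \<le> e / (2 * norm z) * norm z"
      using z by (intro mult_right_mono) (auto simp: t_def)
    also have "\<dots> < e" using z assms by simp
    finally show "t * norm z < e" .
    have "t * (norm z)\<^sup>2 \<le> 1 / (norm z)\<^sup>2 * (norm z)\<^sup>2"
      by (intro mult_right_mono) (auto simp: t_def)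
    then show "t * (norm z)\<^sup>2 \<le> 1" using z by simp
  qed
  have "sin (t * (norm z)\<^sup>2) > 0"
    using t z pi_gt3 by (intro sin_gt_zero) auto
  then have "Im (character z (t *\<^sub>R z)) < 0"
    by (simp add: character_def Im_exp power2_norm_eq_inner)
  moreover have "character z (t *\<^sub>R z) = character x (t *\<^sub>R z) * cnj (character y (t *\<^sub>R z))"
    by (simp add: z_def character_diff)
  moreover have "w * cnj w = of_real ((cmod w)\<^sup>2)" for w by (metis complex_norm_square)
  ultimately have "character x (t *\<^sub>R z) \<noteq> character y (t *\<^sub>R z)"
    by (metis Im_complex_of_real less_irrefl)
  moreover have "norm (t *\<^sub>R z) < e" using t by simp
  ultimately show thesis by (rule that[rotated])
qed

text \<open>Induction on the number of characters: a translation by \<open>h\<close> multiplies \<open>character x\<close>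
  by the constant \<open>character x h\<close>, so subtracting \<open>character y h\<close> times the relation from its translate
  eliminates \<open>y\<close>, at the price of a slightly smaller open set.\<close>

lemma character_independent:
  assumes "finite S" "open U" "U \<noteq> {}"
    and "\<And>p. p \<in> U \<Longrightarrow> (\<Sum>x\<in>S. a x * character x p) = 0" and "x \<in> S"
  shows "a x = 0"
  using assms
proof (induction S arbitrary: a U x rule: finite_induct)
  case empty then show ?case by simp
next
  case (insert y S)
  have "open U" by fact
  have van: "(\<Sum>x\<in>S. a x * character x p) + a y * character y p = 0" if "p \<in> U" for p
    using insert.prems(3)[OF that] insert.hyps by (simp add: add.commute)
  obtain p0 where "p0 \<in> U" using insert.prems by auto
  then obtain e where e: "e > 0" "ball p0 e \<subseteq> U" using \<open>open U\<close> openE by blast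
  have zero: "a x = 0" if "x \<in> S" for x
  proof -
    have "x \<noteq> y" using that insert.hyps by auto
    then obtain h where h: "norm h < e" "character x h \<noteq> character y h"
      using character_separates e(1) by metis
    define V where "V = U \<inter> (\<lambda>p. p + h) -` U"
    have "open V" unfolding V_def
      using \<open>open U\<close> by (intro open_Int open_vimage) (auto intro!: continuous_intros)
    moreover have "p0 \<in> V" using \<open>p0 \<in> U\<close> e(2) h(1) by (auto simp: V_def dist_norm)
    moreover have "(\<Sum>x\<in>S. (a x * (character x h - character y h)) * character x p) = 0"
      if "p \<in> V" for p
    proof -
      have "(\<Sum>x\<in>S. (a x * (character x h - character y h)) * character x p) =
        (\<Sum>x\<in>S. a x * character x (p + h)) - character y h * (\<Sum>x\<in>S. a x * character x p)"
        by (simp add: character_add sum_distrib_left sum_subtractf algebra_simps)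
      also have "\<dots> = - a y * character y (p + h) - character y h * (- a y * character y p)"
        using van[of p] van[of "p + h"] that by (simp add: V_def add_eq_0_iff2)
      also have "\<dots> = 0" by (simp add: character_add)
      finally show ?thesis .
    qed
    ultimately have "a x * (character x h - character y h) = 0"
      using insert.IH[of V "\<lambda>x. a x * (character x h - character y h)" x] that by blast
    then show ?thesis using h by simp
  qed
  then have "a y = 0" using van[OF \<open>p0 \<in> U\<close>] by simp
  then show ?case using zero insert.prems by auto
qed

text \<open>A vanishing exponential sum vanishes frequency by frequency, so any set \<open>Q\<close> of
  frequencies may be singled out. The family \<open>\<xi>\<close> may repeat frequencies, as happens for products of sums.\<close>

lemma character_sum_restrict:
  assumes "finite I" "open U" "U \<noteq> {}"
    and van: "\<And>p. p \<in> U \<Longrightarrow> (\<Sum>i\<in>I. a i * character (\<xi> i) p) = 0"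
  shows "(\<Sum>i\<in>{i\<in>I. \<xi> i \<in> Q}. a i * character (\<xi> i) p) = 0"
proof -
  have group: "(\<Sum>i\<in>J. a i * character (\<xi> i) p) =
      (\<Sum>x\<in>\<xi> ` J. (\<Sum>i\<in>{i\<in>J. \<xi> i = x}. a i) * character x p)" if "finite J" for J p
    by (subst sum.image_gen[OF that, of _ \<xi>]) (auto simp: sum_distrib_right intro!: sum.cong)
  have coeff: "(\<Sum>i\<in>{i\<in>I. \<xi> i = x}. a i) = 0" if "x \<in> \<xi> ` I" for x
    using character_independent[of "\<xi> ` I" U "\<lambda>x. \<Sum>i\<in>{i\<in>I. \<xi> i = x}. a i" x]
      assms group[of I] that by auto
  have "{i \<in> {i\<in>I. \<xi> i \<in> Q}. \<xi> i = x} = {i\<in>I. \<xi> i = x}" if "x \<in> Q" for x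
    using that by auto
  then show ?thesis
    using assms(1) coeff by (subst group) (auto intro!: sum.neutral)
qed

lemma character_sum_zero:
  assumes "finite I" "inj_on \<xi> I" "open U" "U \<noteq> {}"
    and "\<And>p. p \<in> U \<Longrightarrow> (\<Sum>i\<in>I. a i * character (\<xi> i) p) = 0" and "i \<in> I"
  shows "a i = 0"
proof -
  have "{j\<in>I. \<xi> j \<in> {\<xi> i}} = {i}" using assms by (auto dest: inj_onD)
  then show ?thesis using character_sum_restrict[OF assms(1,3,4,5), where Q = "{\<xi> i}" and p = 0] by simp
qed

text \<open>With \<open>F\<close> and \<open>G\<close> the two sums, \<open>2 Re (F cnj G)\<close> is the sum of \<open>F cnj G\<close>, with
  frequencies in \<open>D - E\<close>, and of its conjugate, with frequencies in \<open>E - D\<close>. As these sets are disjoint, each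
  summand vanishes separately. Then \<open>F\<close> vanishes on the open set where \<open>G\<close> does not.\<close>

lemma interference_determines:
  fixes \<xi> :: "'i \<Rightarrow> 'a::euclidean_space"
  assumes fin: "finite A" "finite B" and inj: "inj_on \<xi> A" "inj_on \<xi> B"
    and sub: "\<xi> ` A \<subseteq> D" "\<xi> ` B \<subseteq> E" and conv: "convex D" "convex E" and disj: "D \<inter> E = {}"
    and U: "open U" "U \<noteq> {}"
    and re: "\<And>p. p \<in> U \<Longrightarrow> Re ((\<Sum>x\<in>A. f x * character (\<xi> x) p) *
        cnj (\<Sum>y\<in>B. g y * character (\<xi> y) p)) = 0"
    and g: "y \<in> B" "g y \<noteq> 0" and x: "x \<in> A"
  shows "f x = 0"
proof -
  define F where "F p = (\<Sum>x\<in>A. f x * character (\<xi> x) p)" for p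
  define G where "G p = (\<Sum>y\<in>B. g y * character (\<xi> y) p)" for p
  define a where "a = case_sum (\<lambda>(x, y). f x * cnj (g y)) (\<lambda>(x, y). cnj (f x) * g y)"
  define \<zeta> where "\<zeta> = case_sum (\<lambda>(x, y). \<xi> x - \<xi> y) (\<lambda>(x, y). \<xi> y - \<xi> x)"
  define I where "I = (A \<times> B) <+> (A \<times> B)"
  define Q where "Q = {x - y |x y. x \<in> D \<and> y \<in> E}"
  have left: "(\<Sum>i\<in>A \<times> B. a (Inl i) * character (\<zeta> (Inl i)) p) = F p * cnj (G p)" for p
    by (simp add: a_def \<zeta>_def F_def G_def character_diff sum_product sum.cartesian_product
        split_def mult_ac)
  have right: "(\<Sum>i\<in>A \<times> B. a (Inr i) * character (\<zeta> (Inr i)) p) = cnj (F p * cnj (G p))" for p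
    by (simp add: a_def \<zeta>_def F_def G_def character_diff sum_product sum.cartesian_product
        split_def mult_ac)
  have "(\<Sum>i\<in>I. a i * character (\<zeta> i) p) = 0" if "p \<in> U" for p
  proof -
    have "(\<Sum>i\<in>I. a i * character (\<zeta> i) p) = F p * cnj (G p) + cnj (F p * cnj (G p))"
      unfolding I_def using fin left[of p] right[of p] by (simp add: sum.Plus o_def)
    also have "\<dots> = 0" unfolding complex_add_cnj F_def G_def by (simp only: re[OF that]) simp
    finally show ?thesis .
  qed
  then have "(\<Sum>i\<in>{i\<in>I. \<zeta> i \<in> Q}. a i * character (\<zeta> i) p) = 0" for p
    using character_sum_restrict[where I = I and U = U and a = a and \<xi> = \<zeta> and Q = Q and p = p] U fin by (auto simp: I_def)
  \<comment> \<open>A common element \<open>x - y = y' - x'\<close> of \<open>D - E\<close> and \<open>E - D\<close> would make the midpoint of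
    \<open>x, x'\<close> equal to that of \<open>y, y'\<close>, a point of \<open>D \<inter> E\<close>.\<close>
  moreover have "{i\<in>I. \<zeta> i \<in> Q} = Inl ` (A \<times> B)"
  proof -
    have "\<xi> y - \<xi> x \<notin> Q" if "x \<in> A" "y \<in> B" for x y
    proof
      assume "\<xi> y - \<xi> x \<in> Q"
      then obtain x' y' where xy: "\<xi> y - \<xi> x = x' - y'" "x' \<in> D" "y' \<in> E" by (auto simp: Q_def)
      then have eq: "(1/2) *\<^sub>R \<xi> x + (1/2) *\<^sub>R x' = (1/2) *\<^sub>R \<xi> y + (1/2) *\<^sub>R y'"
        by (metis add.commute diff_add_eq diff_eq_eq scaleR_add_right)
      have "(1/2) *\<^sub>R \<xi> x + (1/2) *\<^sub>R x' \<in> D" "(1/2) *\<^sub>R \<xi> y + (1/2) *\<^sub>R y' \<in> E"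
        using that sub xy by (auto intro!: convexD conv)
      then show False using eq disj by auto
    qed
    moreover have "\<xi> x - \<xi> y \<in> Q" if "x \<in> A" "y \<in> B" for x y
      using that sub unfolding Q_def by blast
    ultimately show ?thesis by (auto simp: I_def \<zeta>_def)
  qed
  ultimately have prod: "F p * cnj (G p) = 0" for p
    using left[of p] by (simp add: sum.reindex)
  obtain p1 where "G p1 \<noteq> 0"
    using character_sum_zero[OF fin(2) inj(2) open_UNIV UNIV_not_empty, of g y] g
    unfolding G_def by blast
  have "continuous_on UNIV G"
    unfolding G_def character_def by (intro continuous_intros)
  then have "open {p. G p \<noteq> 0}" by (intro open_Collect_neq) (auto intro: continuous_intros)
  moreover have "{p. G p \<noteq> 0} \<noteq> {}" using \<open>G p1 \<noteq> 0\<close> by auto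
  moreover have "F p = 0" if "p \<in> {p. G p \<noteq> 0}" for p using prod[of p] that by simp
  ultimately show ?thesis
    using character_sum_zero[OF fin(1) inj(1), of "{p. G p \<noteq> 0}" f x] x unfolding F_def by blast
qed

section \<open>Products of circles with a large sum of cosines\<close>

text \<open>Bounding all other terms by 1 gives \<open>c i + c j > 0\<close> for \<open>i \<noteq> j\<close> as soon as the total exceeds
  \<open>d - 2\<close>, so a nonpositive \<open>c i\<close> is dominated by every other one.\<close>

lemma sum_two_le:
  fixes c :: "'n::finite \<Rightarrow> real"
  assumes "\<And>i. c i \<le> 1" "i \<noteq> j"
  shows "sum c UNIV \<le> c i + c j + (real CARD('n) - 2)"
proof -
  have "sum c UNIV = sum c {i, j} + sum c (UNIV - {i, j})"
    using sum.subset_diff[of "{i, j}" UNIV c] by simp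
  also have "sum c (UNIV - {i, j}) \<le> real (card (UNIV - {i, j}))"
    using sum_bounded_above[of "UNIV - {i, j}" c 1] assms by simp
  also have "real (card (UNIV - {i, j})) = real CARD('n) - 2"
  proof -
    have "card {i, j} \<le> CARD('n)" by (intro card_mono) auto
    then show ?thesis using assms(2) by (simp add: card_Diff_subset of_nat_diff)
  qed
  finally show ?thesis using assms(2) by simp
qed

lemma circle_coord_le:
  fixes c s :: real assumes "c\<^sup>2 + s\<^sup>2 = 1" shows "\<bar>c\<bar> \<le> 1"
proof -
  have "c\<^sup>2 \<le> 1" using assms by (metis le_add_same_cancel1 zero_le_power2)
  then show ?thesis by (simp add: abs_square_le_1)
qed

text \<open>If all sines vanish, the cosines are \<open>\<plusminus>1\<close>, and their sum is either \<open>d\<close> or at most \<open>d - 2\<close>.\<close>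

lemma direction_nonzero:
  fixes c s :: "'n::finite \<Rightarrow> real"
  assumes circ: "\<And>i. (c i)\<^sup>2 + (s i)\<^sup>2 = 1" and card: "CARD('n) \<ge> 2"
    and lo: "sum c UNIV > real CARD('n) - 2" and hi: "sum c UNIV < real CARD('n)"
  shows "\<exists>i. s i \<noteq> 0"
proof (rule ccontr)
  assume "\<not> ?thesis"
  then have c: "c i = 1 \<or> c i = -1" for i using circ[of i] by (simp add: power2_eq_1_iff)
  have "\<exists>i. c i \<noteq> 1"
  proof (rule ccontr)
    assume "\<nexists>i. c i \<noteq> 1" then have "sum c UNIV = (\<Sum>i\<in>(UNIV::'n set). 1)" by (intro sum.cong) auto
    then show False using hi by simp
  qed
  then obtain i where i: "c i = -1" using c by auto
  have "UNIV \<noteq> {i}"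
  proof
    assume "UNIV = {i}" then have "CARD('n) = card {i}" by (rule arg_cong)
    then show False using card by simp
  qed
  then obtain j where "j \<noteq> i" by auto
  have "c k \<le> 1" for k using c[of k] by auto
  then have "sum c UNIV \<le> c i + c j + (real CARD('n) - 2)"
    using \<open>j \<noteq> i\<close> by (intro sum_two_le) auto
  then show False using i c[of j] lo by auto
qed

text \<open>The form \<open>\<Sum> c i (u i)\<^sup>2\<close> on the tangent space \<open>s\<^sup>\<bottom>\<close> has no isotropic vector. Only the case
  \<open>c j = - a \<le> 0\<close> is not immediate. There the tangency equation and Cauchy-Schwarz give
  \<open>(1 - a\<^sup>2) (u j)\<^sup>2 \<le> C \<Sum>\<^sub>i\<^sub>\<noteq>\<^sub>j c i (u i)\<^sup>2 = a C (u j)\<^sup>2\<close> with \<open>C = \<Sum>\<^sub>i\<^sub>\<noteq>\<^sub>j (s i)\<^sup>2 / c i\<close>, and the bound on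
  the sum of cosines makes \<open>a C < 1 - a\<^sup>2\<close>.\<close>

lemma form_definite:
  fixes c s u :: "'n::finite \<Rightarrow> real"
  assumes circ: "\<And>i. (c i)\<^sup>2 + (s i)\<^sup>2 = 1"
    and lo: "sum c UNIV > real CARD('n) - 2"
    and tangent: "(\<Sum>i\<in>UNIV. s i * u i) = 0" and null: "(\<Sum>i\<in>UNIV. c i * (u i)\<^sup>2) = 0"
  shows "u i = 0"
proof -
  have c1: "c i \<le> 1" for i using circle_coord_le[OF circ[of i]] by simp
  show ?thesis
  proof (cases "\<forall>i. c i > 0")
    case True
    then have "\<forall>i\<in>UNIV. c i * (u i)\<^sup>2 = 0"
      using null by (subst (asm) sum_nonneg_eq_0_iff) (auto simp: less_imp_le)
    then have "c i * (u i)\<^sup>2 = 0" by simp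
    then show ?thesis using True[rule_format, of i] by simp
  next
    case False
    then obtain j where j: "c j \<le> 0" by (auto simp: not_less)
    define a where "a = - c j"
    define R where "R = UNIV - {j}"
    have a: "0 \<le> a" using j by (simp add: a_def)
    have split: "sum h UNIV = h j + sum h R" for h :: "'n \<Rightarrow> real"
      unfolding R_def by (simp add: sum.remove)
    have ca: "c i > a" if "i \<in> R" for i
      using sum_two_le[of c i j] c1 lo that by (auto simp: R_def a_def)
    then have cpos: "c i > 0" if "i \<in> R" for i using that a by (meson le_less_trans)
    define C where "C = (\<Sum>i\<in>R. (s i)\<^sup>2 / c i)"
    have eq1: "(\<Sum>i\<in>R. s i * u i) = - s j * u j" using tangent split[of "\<lambda>i. s i * u i"] by simp
    have eq2: "(\<Sum>i\<in>R. c i * (u i)\<^sup>2) = a * (u j)\<^sup>2"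
      using null split[of "\<lambda>i. c i * (u i)\<^sup>2"] by (simp add: a_def)
    have "(\<Sum>i\<in>R. s i * u i)\<^sup>2 = (\<Sum>i\<in>R. (s i / sqrt (c i)) * (sqrt (c i) * u i))\<^sup>2"
      using cpos by (intro arg_cong[where f = "\<lambda>x. x\<^sup>2"] sum.cong) force+
    also have "\<dots> \<le> (\<Sum>i\<in>R. (s i / sqrt (c i))\<^sup>2) * (\<Sum>i\<in>R. (sqrt (c i) * u i)\<^sup>2)"
      by (rule Cauchy_Schwarz_ineq_sum)
    also have "(\<Sum>i\<in>R. (s i / sqrt (c i))\<^sup>2) = C"
      unfolding C_def using cpos by (intro sum.cong) (auto simp: power_divide less_imp_le)
    also have "(\<Sum>i\<in>R. (sqrt (c i) * u i)\<^sup>2) = a * (u j)\<^sup>2"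
      unfolding eq2[symmetric] using cpos by (intro sum.cong) (auto simp: power_mult_distrib less_imp_le)
    finally have "(s j)\<^sup>2 * (u j)\<^sup>2 \<le> a * C * (u j)\<^sup>2"
      unfolding eq1 by (simp add: power_mult_distrib mult_ac)
    moreover have "(s j)\<^sup>2 = 1 - a\<^sup>2" using circ[of j] by (simp add: a_def)
    ultimately have le: "(1 - a\<^sup>2) * (u j)\<^sup>2 \<le> a * C * (u j)\<^sup>2" by simp
    have "a * C \<le> (\<Sum>i\<in>R. (1 + a) * (1 - c i))"
      unfolding C_def sum_distrib_left
    proof (intro sum_mono)
      fix i assume i: "i \<in> R"
      have "a * (1 + c i) \<le> (1 + a) * c i" using ca[OF i] by (simp add: algebra_simps)
      then have "(1 - c i) * (a * (1 + c i)) \<le> (1 - c i) * ((1 + a) * c i)"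
        using c1 by (intro mult_left_mono) auto
      moreover have "a * (s i)\<^sup>2 = (1 - c i) * (a * (1 + c i))"
      proof -
        have "(s i)\<^sup>2 = 1 - (c i)\<^sup>2" using circ[of i] by simp
        then show ?thesis by (simp only:) (simp add: power2_eq_square algebra_simps)
      qed
      ultimately have "a * (s i)\<^sup>2 \<le> (1 + a) * (1 - c i) * c i" by (simp only: mult_ac)
      then show "a * ((s i)\<^sup>2 / c i) \<le> (1 + a) * (1 - c i)"
        using cpos[OF i] by (simp add: divide_simps)
    qed
    also have "\<dots> = (1 + a) * (real (card R) - sum c R)"
      by (simp add: sum_subtractf flip: sum_distrib_left)
    also have "\<dots> < (1 + a) * (1 - a)"
    proof -
      have "real (card R) = real CARD('n) - 1" by (simp add: R_def card_Diff_subset of_nat_diff)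
      then show ?thesis using a lo split[of c] by (intro mult_strict_left_mono) (auto simp: a_def)
    qed
    finally have "a * C < 1 - a\<^sup>2" by (simp add: power2_eq_square algebra_simps)
    then have "(u j)\<^sup>2 > 0 \<Longrightarrow> a * C * (u j)\<^sup>2 < (1 - a\<^sup>2) * (u j)\<^sup>2"
      by (rule mult_strict_right_mono)
    with le have uj: "u j = 0" by (cases "u j = 0") auto
    then have "(\<Sum>i\<in>R. c i * (u i)\<^sup>2) = 0" using eq2 by simp
    then have "\<forall>i\<in>R. c i * (u i)\<^sup>2 = 0"
      using cpos by (subst (asm) sum_nonneg_eq_0_iff) (auto simp: R_def less_imp_le)
    then have "c i * (u i)\<^sup>2 = 0" if "i \<in> R" using that by blast
    then show ?thesis using uj cpos[of i] by (cases "i = j") (auto simp: R_def)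
  qed
qed

lemma argmax_abs:
  fixes \<eta> :: "'n::finite \<Rightarrow> real"
  shows "\<exists>j. \<forall>i. \<bar>\<eta> i\<bar> \<le> \<bar>\<eta> j\<bar>"
proof -
  have "Max (range (\<lambda>i. \<bar>\<eta> i\<bar>)) \<in> range (\<lambda>i. \<bar>\<eta> i\<bar>)" by (intro Max_in) auto
  then obtain j where "Max (range (\<lambda>i. \<bar>\<eta> i\<bar>)) = \<bar>\<eta> j\<bar>" by (rule imageE)
  then have "\<bar>\<eta> i\<bar> \<le> \<bar>\<eta> j\<bar>" for i by (metis Max_ge finite finite_imageI rangeI)
  then show ?thesis by blast
qed

text \<open>When \<open>s j\<close> is largest in absolute value, every other cosine is nonnegative, for a negative
  \<open>c i\<close> would need \<open>\<bar>c i\<bar> < c j\<close> and hence \<open>\<bar>s i\<bar> > \<bar>s j\<bar>\<close>. So the direction \<open>\<rho>\<close> of \<open>s\<close> and the single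
  number \<open>c j\<close> determine all cosines.\<close>

lemma dominant_coordinate:
  fixes c s \<rho> :: "'n::finite \<Rightarrow> real"
  assumes circ: "\<And>i. (c i)\<^sup>2 + (s i)\<^sup>2 = 1"
    and lo: "sum c UNIV > real CARD('n) - 2"
    and s: "\<And>i. s i = \<rho> i * s j" and \<rho>: "\<And>i. \<bar>\<rho> i\<bar> \<le> 1" and "i \<noteq> j"
  shows "c i = sqrt (1 - (\<rho> i)\<^sup>2 + (\<rho> i)\<^sup>2 * (c j)\<^sup>2)"
proof -
  have c1: "c i \<le> 1" for i using circle_coord_le[OF circ[of i]] by simp
  have "c i + c j > 0" using sum_two_le[of c i j, OF c1 \<open>i \<noteq> j\<close>] lo by simp
  have "(\<rho> i)\<^sup>2 * (s j)\<^sup>2 \<le> 1 * (s j)\<^sup>2"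
    using \<rho>[of i] by (intro mult_right_mono) (auto simp: abs_square_le_1)
  then have "(s i)\<^sup>2 \<le> (s j)\<^sup>2" using s[of i] by (simp add: power_mult_distrib)
  then have "(c j)\<^sup>2 \<le> (c i)\<^sup>2" using circ[of i] circ[of j] by simp
  then have "\<bar>c j\<bar> \<le> \<bar>c i\<bar>" by (simp add: abs_le_square_iff)
  then have "c i \<ge> 0" using \<open>c i + c j > 0\<close> by linarith
  moreover have "(c i)\<^sup>2 = 1 - (\<rho> i)\<^sup>2 + (\<rho> i)\<^sup>2 * (c j)\<^sup>2"
  proof -
    have "(c i)\<^sup>2 = 1 - (\<rho> i)\<^sup>2 * (s j)\<^sup>2" using circ[of i] s[of i] by (simp add: power_mult_distrib)
    moreover have "(s j)\<^sup>2 = 1 - (c j)\<^sup>2" using circ[of j] by simp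
    ultimately show ?thesis by (simp add: algebra_simps)
  qed
  ultimately show ?thesis by (simp add: real_sqrt_unique)
qed

text \<open>The sum of the cosines of a point whose sines are proportional to \<open>\<rho>\<close>, with \<open>\<rho> j = 1\<close> of
  largest absolute value, as a function of \<open>x = c j\<close>.\<close>

definition profile :: "'n \<Rightarrow> ('n::finite \<Rightarrow> real) \<Rightarrow> real \<Rightarrow> real" where
  "profile j \<rho> x = x + (\<Sum>i\<in>UNIV - {j}. sqrt (1 - (\<rho> i)\<^sup>2 + (\<rho> i)\<^sup>2 * x\<^sup>2))"

lemma profile_ends:
  fixes j :: "'n::finite"
  shows "profile j \<rho> (- 1) = real CARD('n) - 2" "profile j \<rho> 1 = real CARD('n)"
proof -
  have "1 \<le> CARD('n)" by simp
  then show "profile j \<rho> (- 1) = real CARD('n) - 2" "profile j \<rho> 1 = real CARD('n)"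
    by (simp_all add: profile_def card_Diff_subset of_nat_diff)
qed

text \<open>Each summand is the Euclidean norm of a vector in the plane that is affine in \<open>x\<close>.\<close>

lemma convex_on_profile:
  fixes j :: "'n::finite"
  assumes "\<And>i. \<bar>\<rho> i\<bar> \<le> 1"
  shows "convex_on UNIV (profile j \<rho>)"
proof -
  have root: "convex_on UNIV (\<lambda>x::real. sqrt (1 - (\<rho> i)\<^sup>2 + (\<rho> i)\<^sup>2 * x\<^sup>2))" for i
  proof (rule convex_onI)
    fix t x y :: real assume t: "0 < t" "t < 1"
    define A where "A x = (sqrt (1 - (\<rho> i)\<^sup>2), \<rho> i * x)" for x
    have nrm: "norm (A x) = sqrt (1 - (\<rho> i)\<^sup>2 + (\<rho> i)\<^sup>2 * x\<^sup>2)" for x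
      using assms[of i] by (simp add: A_def norm_Pair power_mult_distrib abs_square_le_1)
    have "A ((1 - t) *\<^sub>R x + t *\<^sub>R y) = (1 - t) *\<^sub>R A x + t *\<^sub>R A y"
      by (simp add: A_def algebra_simps)
    then have "norm (A ((1 - t) *\<^sub>R x + t *\<^sub>R y)) \<le> (1 - t) * norm (A x) + t * norm (A y)"
      using norm_triangle_ineq[of "(1 - t) *\<^sub>R A x" "t *\<^sub>R A y"] t by simp
    then show "sqrt (1 - (\<rho> i)\<^sup>2 + (\<rho> i)\<^sup>2 * ((1 - t) *\<^sub>R x + t *\<^sub>R y)\<^sup>2) \<le>
      (1 - t) * sqrt (1 - (\<rho> i)\<^sup>2 + (\<rho> i)\<^sup>2 * x\<^sup>2) + t * sqrt (1 - (\<rho> i)\<^sup>2 + (\<rho> i)\<^sup>2 * y\<^sup>2)"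
      unfolding nrm .
  qed auto
  have "convex_on UNIV (\<lambda>x::real. \<Sum>i\<in>S. sqrt (1 - (\<rho> i)\<^sup>2 + (\<rho> i)\<^sup>2 * x\<^sup>2))"
    if "finite S" for S
    using that by (induct S rule: finite_induct) (auto simp: convex_on_const intro: root)
  then show ?thesis
    unfolding profile_def by (intro convex_on_add) (auto simp: convex_on_ident)
qed

text \<open>A convex function cannot take a value above its value at the left end \<open>-1\<close> twice: at the
  smaller of the two points it would have to be below the chord from \<open>-1\<close> to the larger one.\<close>

lemma profile_inj:
  fixes j :: "'n::finite"
  assumes \<rho>: "\<And>i. \<bar>\<rho> i\<bar> \<le> 1" and eq: "profile j \<rho> x = profile j \<rho> y"
    and lo: "profile j \<rho> x > real CARD('n) - 2" and "-1 \<le> x" "x < y"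
  shows False
proof -
  define t where "t = (x + 1) / (y + 1)"
  have t: "0 \<le> t" "t < 1" using assms(4,5) by (auto simp: t_def divide_simps)
  have "t * (y + 1) = x + 1" using assms(4,5) by (simp add: t_def)
  then have x: "x = (1 - t) *\<^sub>R (- 1) + t *\<^sub>R y" by (simp add: algebra_simps)
  have "profile j \<rho> x \<le> (1 - t) * profile j \<rho> (- 1) + t * profile j \<rho> y"
    using convex_onD[OF convex_on_profile[where \<rho> = \<rho> and j = j, OF \<rho>], of t "-1" y] t unfolding x[symmetric] by simp
  then have "(1 - t) * profile j \<rho> x \<le> (1 - t) * (real CARD('n) - 2)"
    by (simp add: profile_ends eq algebra_simps)
  then show False using t lo by (simp add: mult_le_cancel_left)
qed

text \<open>Injectivity of the Gauss map: a coordinate \<open>j\<close> where the direction \<open>\<eta>\<close> is largest can be chosen for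
  both points at once, so that both are governed by the same profile.\<close>

lemma gauss_unique:
  fixes c s c' s' \<eta> :: "'n::finite \<Rightarrow> real"
  assumes circ: "\<And>i. (c i)\<^sup>2 + (s i)\<^sup>2 = 1" "\<And>i. (c' i)\<^sup>2 + (s' i)\<^sup>2 = 1"
    and lo: "sum c UNIV > real CARD('n) - 2" and eq: "sum c UNIV = sum c' UNIV"
    and dir: "\<And>i. s i = r * \<eta> i" "\<And>i. s' i = r' * \<eta> i" "r > 0" "r' > 0"
    and nz: "\<exists>i. \<eta> i \<noteq> 0"
  shows "c = c' \<and> s = s'"
proof -
  obtain j where j: "\<And>i. \<bar>\<eta> i\<bar> \<le> \<bar>\<eta> j\<bar>" using argmax_abs[of \<eta>] by blast
  then have \<eta>j: "\<eta> j \<noteq> 0" using nz by (metis abs_le_zero_iff abs_0)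
  define \<rho> where "\<rho> i = \<eta> i / \<eta> j" for i
  have \<rho>: "\<bar>\<rho> i\<bar> \<le> 1" for i using j[of i] \<eta>j by (simp add: \<rho>_def divide_simps)
  have s: "s i = \<rho> i * s j" "s' i = \<rho> i * s' j" for i
    using \<eta>j dir(1)[of i] dir(1)[of j] dir(2)[of i] dir(2)[of j] by (simp_all add: \<rho>_def)
  note dom = dominant_coordinate[where \<rho> = \<rho> and j = j, OF circ(1) lo s(1) \<rho>]
    dominant_coordinate[where \<rho> = \<rho> and j = j, OF circ(2) lo[unfolded eq] s(2) \<rho>]
  have prof: "sum c UNIV = profile j \<rho> (c j)" "sum c' UNIV = profile j \<rho> (c' j)"
    unfolding profile_def by (simp_all add: sum.remove[of UNIV j] dom)
  have "- 1 \<le> c j" "- 1 \<le> c' j"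
    using circle_coord_le[OF circ(1)[of j]] circle_coord_le[OF circ(2)[of j]] by auto
  then have cj: "c j = c' j"
    using profile_inj[of \<rho> j "c j" "c' j"] profile_inj[of \<rho> j "c' j" "c j"] \<rho> prof eq lo
    by (metis linorder_neqE_linordered_idom)
  then have "(s j)\<^sup>2 = (s' j)\<^sup>2" using circ(1)[of j] circ(2)[of j] by simp
  moreover have "s j * s' j > 0"
  proof -
    have "s j * s' j = (r * r') * (\<eta> j)\<^sup>2" using dir by (simp add: power2_eq_square)
    then show ?thesis using \<eta>j dir(3,4) by simp
  qed
  ultimately have sj: "s j = s' j" by (auto simp: power2_eq_iff zero_less_mult_iff)
  have "c i = c' i" for i using dom[of i] cj by (cases "i = j") auto
  moreover have "s i = s' i" for i using s[of i] sj by simp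
  ultimately show ?thesis by auto
qed

text \<open>Surjectivity of the Gauss map: the profile is continuous and runs from \<open>d - 2\<close> to \<open>d\<close>.\<close>

lemma gauss_exists:
  fixes \<eta> :: "'n::finite \<Rightarrow> real"
  assumes "real CARD('n) - 2 < \<Lambda>" "\<Lambda> < real CARD('n)" and nz: "\<exists>i. \<eta> i \<noteq> 0"
  obtains c s r where "\<And>i. (c i)\<^sup>2 + (s i)\<^sup>2 = 1" "sum c UNIV = \<Lambda>" "\<And>i. s i = r * \<eta> i" "r > 0"
proof -
  obtain j where j: "\<And>i. \<bar>\<eta> i\<bar> \<le> \<bar>\<eta> j\<bar>" using argmax_abs[of \<eta>] by blast
  then have \<eta>j: "\<eta> j \<noteq> 0" using nz by (metis abs_le_zero_iff abs_0)
  define \<rho> where "\<rho> i = \<eta> i / \<eta> j" for i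
  have \<rho>: "(\<rho> i)\<^sup>2 \<le> 1" for i using j[of i] \<eta>j by (simp add: \<rho>_def abs_square_le_1)
  have \<rho>j: "\<rho> j = 1" using \<eta>j by (simp add: \<rho>_def)
  have "continuous_on {-1..1} (profile j \<rho>)"
    unfolding profile_def by (intro continuous_intros)
  then obtain x where x: "- 1 \<le> x" "x \<le> 1" "profile j \<rho> x = \<Lambda>"
    using IVT'[of "profile j \<rho>" "-1" \<Lambda> 1] assms by (auto simp: profile_ends)
  have "x \<noteq> 1" "x \<noteq> -1" using x(3) assms by (auto simp: profile_ends)
  then have "\<bar>x\<bar> < 1" using x by auto
  then have x2: "x\<^sup>2 < 1" by (simp add: abs_square_less_1)
  define r where "r = sqrt (1 - x\<^sup>2) / \<bar>\<eta> j\<bar>"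
  define c where "c i = (if i = j then x else sqrt (1 - (\<rho> i)\<^sup>2 + (\<rho> i)\<^sup>2 * x\<^sup>2))" for i
  define s where "s i = r * \<eta> i" for i
  have "r > 0" using x2 \<eta>j by (simp add: r_def)
  moreover have "sum c UNIV = \<Lambda>"
    using x(3) by (simp add: profile_def c_def sum.remove[of UNIV j])
  moreover have "(c i)\<^sup>2 + (s i)\<^sup>2 = 1" for i
  proof -
    have "(s i)\<^sup>2 = (1 - x\<^sup>2) * (\<rho> i)\<^sup>2"
      using x2 \<eta>j by (simp add: s_def r_def \<rho>_def power_mult_distrib power_divide)
    moreover have "(c i)\<^sup>2 = 1 - (\<rho> i)\<^sup>2 + (\<rho> i)\<^sup>2 * x\<^sup>2"
      using \<rho>[of i] \<rho>j by (auto simp: c_def)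
    ultimately show ?thesis by (simp add: algebra_simps)
  qed
  ultimately show thesis by (intro that[of c s r]) (auto simp: s_def)
qed

section \<open>The surface, its Gauss map and its curvature\<close>

lemma has_derivative_vec_nth: "((\<lambda>k. k $ i) has_derivative (\<lambda>h. h $ i)) (at k)"
  by (rule bounded_linear.has_derivative[OF bounded_linear_vec_nth has_derivative_ident])

lemma has_derivative_chi:
  fixes f :: "'a::real_normed_vector \<Rightarrow> 'n::finite \<Rightarrow> real"
  assumes "\<And>i. ((\<lambda>x. f x i) has_derivative (\<lambda>h. f' h i)) (at x)"
  shows "((\<lambda>x. \<chi> i. f x i) has_derivative (\<lambda>h. \<chi> i. f' h i)) (at x)"
  using assms
  by (subst has_derivative_componentwise_within) (auto simp: Basis_vec_def inner_axis)

definition phi_gradient :: "real ^ 'n \<Rightarrow> real ^ 'n" where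
  "phi_gradient k = (\<chi> i. - 2 * sin (k $ i))"

lemma phi_lift_has_derivative: "(phi_lift has_derivative (\<lambda>h. phi_gradient k \<bullet> h)) (at k)"
  unfolding phi_lift_def[abs_def]
  by (auto intro!: derivative_eq_intros has_derivative_vec_nth
      simp: phi_gradient_def inner_vec_def sum_distrib_left algebra_simps fun_eq_iff intro!: sum.cong)

lemma gradient_phi_lift: "gradient phi_lift k = phi_gradient k"
  unfolding gradient_def
  by (simp add: frechet_derivative_at[OF phi_lift_has_derivative, symmetric] inner_axis vec_eq_iff)

lemma phi_gradient_has_derivative:
  "(phi_gradient has_derivative (\<lambda>h. \<chi> i. - 2 * cos (k $ i) * h $ i)) (at k)"
  unfolding phi_gradient_def[abs_def]
  by (intro has_derivative_chi) (auto intro!: derivative_eq_intros has_derivative_vec_nth)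

lemma continuous_on_phi_gradient: "continuous_on A phi_gradient"
  by (meson phi_gradient_has_derivative has_derivative_continuous continuous_at_imp_continuous_on)

text \<open>The normalising factor of the unit normal varies too, but its derivative only contributes a multiple
  of the normal itself, which disappears against a tangent vector.\<close>

lemma inner_weingarten:
  assumes "phi_gradient k \<noteq> 0" "phi_gradient k \<bullet> u = 0"
  shows "u \<bullet> weingarten phi_lift k u =
    - 2 * (\<Sum>i\<in>UNIV. cos (k $ i) * (u $ i)\<^sup>2) / norm (phi_gradient k)"
proof -
  have "(\<lambda>k. norm (phi_gradient k)) differentiable (at k)"
    by (rule differentiable_compose[of norm phi_gradient])
      (use assms(1) phi_gradient_has_derivative in \<open>auto intro: differentiableI\<close>)
  then have "(\<lambda>k. inverse (norm (phi_gradient k))) differentiable (at k)"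
    using assms(1) by (intro differentiable_inverse) auto
  then obtain E where E: "((\<lambda>k. inverse (norm (phi_gradient k))) has_derivative E) (at k)"
    by (auto simp: differentiable_def)
  have "(unit_normal phi_lift has_derivative (\<lambda>h. inverse (norm (phi_gradient k)) *\<^sub>R
      (\<chi> i. - 2 * cos (k $ i) * h $ i) + E h *\<^sub>R phi_gradient k)) (at k)"
    unfolding unit_normal_def[abs_def] gradient_phi_lift
    by (rule has_derivative_scaleR[OF E phi_gradient_has_derivative])
  then have "weingarten phi_lift k u = inverse (norm (phi_gradient k)) *\<^sub>R
      (\<chi> i. - 2 * cos (k $ i) * u $ i) + E u *\<^sub>R phi_gradient k"
    unfolding weingarten_def by (simp add: frechet_derivative_at[symmetric])
  then have "u \<bullet> weingarten phi_lift k u =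
      inverse (norm (phi_gradient k)) * (u \<bullet> (\<chi> i. - 2 * cos (k $ i) * u $ i))"
    using assms(2) by (simp add: inner_add_right inner_commute)
  also have "u \<bullet> (\<chi> i. - 2 * cos (k $ i) * u $ i) = - 2 * (\<Sum>i\<in>UNIV. cos (k $ i) * (u $ i)\<^sup>2)"
    by (simp add: inner_vec_def sum_distrib_left power2_eq_square algebra_simps flip: sum_negf)
  finally show ?thesis by (simp add: field_simps)
qed

text \<open>Replacing \<open>cos\<close> by \<open>sgn l * cos\<close> reduces negative energies to positive ones.\<close>

lemma signed_cos:
  fixes k :: "real ^ 'n::finite"
  assumes "phi_lift k = l" "l \<noteq> 0"
  shows "(sgn l * cos (k $ i))\<^sup>2 + (sin (k $ i))\<^sup>2 = 1"
    and "(\<Sum>i\<in>UNIV. sgn l * cos (k $ i)) = \<bar>l\<bar> / 2"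
proof -
  have "(sgn l)\<^sup>2 = 1" using assms(2) by (simp add: sgn_if)
  then show "(sgn l * cos (k $ i))\<^sup>2 + (sin (k $ i))\<^sup>2 = 1"
    by (simp add: power_mult_distrib)
  have "(\<Sum>i\<in>UNIV. sgn l * cos (k $ i)) = sgn l * (l / 2)"
    using assms(1) by (simp add: phi_lift_def flip: sum_distrib_left)
  then show "(\<Sum>i\<in>UNIV. sgn l * cos (k $ i)) = \<bar>l\<bar> / 2" by (simp add: abs_sgn)
qed

lemma phi_gradient_nonzero:
  fixes k :: "real ^ 'n::finite"
  assumes "CARD('n) \<ge> 2" "2 * real CARD('n) - 4 < \<bar>l\<bar>" "\<bar>l\<bar> < 2 * real CARD('n)"
    and "phi_lift k = l"
  shows "phi_gradient k \<noteq> 0"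
proof -
  have "l \<noteq> 0" using assms(1,2) by auto
  then obtain i where "sin (k $ i) \<noteq> 0"
    using direction_nonzero[of "\<lambda>i. sgn l * cos (k $ i)" "\<lambda>i. sin (k $ i)"] assms
      signed_cos[OF assms(4)] by auto
  then show ?thesis by (auto simp: phi_gradient_def vec_eq_iff)
qed

text \<open>A tangent vector in the kernel of the Weingarten map would be isotropic for the second fundamental
  form.\<close>

lemma total_curvature_nonzero:
  fixes k :: "real ^ 'n::finite"
  assumes "CARD('n) \<ge> 2" "2 * real CARD('n) - 4 < \<bar>l\<bar>" "\<bar>l\<bar> < 2 * real CARD('n)"
    and "phi_lift k = l"
  shows "total_curvature phi_lift k \<noteq> 0"
proof -
  have "l \<noteq> 0" using assms(1,2) by auto
  have "0 \<notin> principal_curvatures phi_lift k"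
  proof
    assume "0 \<in> principal_curvatures phi_lift k"
    then obtain u where u: "u \<noteq> 0" "phi_gradient k \<bullet> u = 0" "weingarten phi_lift k u = 0"
      by (auto simp: principal_curvatures_def principal_space_def level_tangent_space_def
          gradient_phi_lift)
    have "(\<Sum>i\<in>UNIV. cos (k $ i) * (u $ i)\<^sup>2) = 0"
      using inner_weingarten[OF phi_gradient_nonzero[OF assms] u(2)] u(3) phi_gradient_nonzero[OF assms] by simp
    then have "(\<Sum>i\<in>UNIV. (sgn l * cos (k $ i)) * (u $ i)\<^sup>2) = 0"
      by (simp only: mult.assoc flip: sum_distrib_left)
    moreover have "(\<Sum>i\<in>UNIV. sin (k $ i) * u $ i) = 0"
    proof -
      have "phi_gradient k \<bullet> u = - 2 * (\<Sum>i\<in>UNIV. sin (k $ i) * u $ i)"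
        by (simp add: phi_gradient_def inner_vec_def sum_distrib_left sum_negf mult.assoc)
      then show ?thesis using u(2) by simp
    qed
    ultimately have "u $ i = 0" for i
      using form_definite[of "\<lambda>i. sgn l * cos (k $ i)" "\<lambda>i. sin (k $ i)" "\<lambda>i. u $ i" i]
        signed_cos[OF assms(4) \<open>l \<noteq> 0\<close>] assms by simp
    then show False using u(1) by (simp add: vec_eq_iff)
  qed
  then show ?thesis unfolding total_curvature_def
    by (cases "finite (principal_curvatures phi_lift k)") (auto simp: prod_zero_iff)
qed

lemma abs_torus_eqI:
  assumes "\<And>i. sin (k $ i) = sin (k' $ i)" "\<And>i. cos (k $ i) = cos (k' $ i)"
  shows "abs_torus k = abs_torus k'"
proof -
  have "\<exists>n::int. k $ i = k' $ i + 2 * pi * n" for i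
    using assms[of i] sin_cos_eq_iff[of "k $ i" "k' $ i"] by simp
  then obtain n :: "'a \<Rightarrow> int" where "\<And>i. k $ i = k' $ i + 2 * pi * n i" by metis
  then have "k = k' + (2 * pi) *\<^sub>R lattice_point (\<chi> i. n i)" by (simp add: vec_eq_iff)
  then show ?thesis by (auto simp: torus.abs_eq_iff torus_rel_def)
qed

lemma gauss_map_inj:
  fixes k q :: "real ^ 'n::finite"
  assumes "CARD('n) \<ge> 2" "2 * real CARD('n) - 4 < \<bar>l\<bar>" "\<bar>l\<bar> < 2 * real CARD('n)"
    and k: "phi_lift k = l" "phi_gradient k /\<^sub>R norm (phi_gradient k) = \<omega>"
    and q: "phi_lift q = l" "phi_gradient q /\<^sub>R norm (phi_gradient q) = \<omega>"
  shows "abs_torus k = abs_torus q"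
proof -
  have "l \<noteq> 0" using assms(1,2) by auto
  note nz = phi_gradient_nonzero[OF assms(1-3) k(1)] phi_gradient_nonzero[OF assms(1-3) q(1)]
  have eq: "phi_gradient k = norm (phi_gradient k) *\<^sub>R \<omega>" "phi_gradient q = norm (phi_gradient q) *\<^sub>R \<omega>"
    subgoal using nz(1) by (simp flip: k(2))
    subgoal using nz(2) by (simp flip: q(2))
    done
  have sin_k: "sin (k $ i) = norm (phi_gradient k) / 2 * (- \<omega> $ i)" for i
    using arg_cong[OF eq(1), of "\<lambda>v. v $ i"] by (simp add: phi_gradient_def)
  have sin_q: "sin (q $ i) = norm (phi_gradient q) / 2 * (- \<omega> $ i)" for i
    using arg_cong[OF eq(2), of "\<lambda>v. v $ i"] by (simp add: phi_gradient_def)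
  have "\<exists>i. - \<omega> $ i \<noteq> 0"
    using nz(1) eq(1) by (metis neg_0_equal_iff_equal scaleR_zero_right vec_eq_iff zero_index)
  then have "(\<lambda>i. sgn l * cos (k $ i)) = (\<lambda>i. sgn l * cos (q $ i)) \<and>
      (\<lambda>i. sin (k $ i)) = (\<lambda>i. sin (q $ i))"
  proof (rule gauss_unique[rotated -1])
    show "sin (k $ i) = norm (phi_gradient k) / 2 * (- \<omega> $ i)" for i by (rule sin_k)
    show "sin (q $ i) = norm (phi_gradient q) / 2 * (- \<omega> $ i)" for i by (rule sin_q)
    show "(\<Sum>i\<in>UNIV. sgn l * cos (k $ i)) > real CARD('n) - 2"
      using assms(2) signed_cos(2)[OF k(1) \<open>l \<noteq> 0\<close>] by simp
    show "(\<Sum>i\<in>UNIV. sgn l * cos (k $ i)) = (\<Sum>i\<in>UNIV. sgn l * cos (q $ i))"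
      using signed_cos(2)[OF k(1) \<open>l \<noteq> 0\<close>] signed_cos(2)[OF q(1) \<open>l \<noteq> 0\<close>] by simp
  qed (use nz signed_cos(1)[OF k(1) \<open>l \<noteq> 0\<close>] signed_cos(1)[OF q(1) \<open>l \<noteq> 0\<close>] in simp_all)
  then show ?thesis using \<open>l \<noteq> 0\<close> by (intro abs_torus_eqI) (auto simp: fun_eq_iff sgn_zero_iff)
qed

lemma gauss_map_surj:
  fixes \<omega> :: "real ^ 'n::finite"
  assumes "CARD('n) \<ge> 2" "2 * real CARD('n) - 4 < \<bar>l\<bar>" "\<bar>l\<bar> < 2 * real CARD('n)"
    and "norm \<omega> = 1"
  obtains k where "phi_lift k = l" "phi_gradient k /\<^sub>R norm (phi_gradient k) = \<omega>"
proof -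
  have "l \<noteq> 0" using assms(1,2) by auto
  have "\<omega> \<noteq> 0" using assms(4) by auto
  then have "\<exists>i. - \<omega> $ i \<noteq> 0" by (auto simp: vec_eq_iff)
  then obtain c s r where cs: "\<And>i. (c i)\<^sup>2 + (s i)\<^sup>2 = 1" "sum c UNIV = \<bar>l\<bar> / 2"
      "\<And>i. s i = r * (- \<omega> $ i)" "r > 0"
    using gauss_exists[of "\<bar>l\<bar> / 2" "\<lambda>i. - \<omega> $ i"] assms(2,3) by auto
  have "\<exists>t. sgn l * c i = cos t \<and> s i = sin t" for i
  proof -
    have "(sgn l)\<^sup>2 = 1" using \<open>l \<noteq> 0\<close> by (simp add: sgn_if)
    then have "(sgn l * c i)\<^sup>2 + (s i)\<^sup>2 = 1" using cs(1)[of i] by (simp add: power_mult_distrib)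
    then show ?thesis by (metis sincos_total_2pi)
  qed
  then obtain t where t: "\<And>i. sgn l * c i = cos (t i)" "\<And>i. s i = sin (t i)" by metis
  define k where "k = (\<chi> i. t i)"
  have "phi_lift k = 2 * (sgn l * sum c UNIV)"
    by (simp add: phi_lift_def k_def sum_distrib_left flip: t(1))
  then have "phi_lift k = l" using cs(2) by (simp add: mult_sgn_abs)
  moreover have "phi_gradient k = (2 * r) *\<^sub>R \<omega>"
    by (simp add: phi_gradient_def k_def vec_eq_iff cs(3) flip: t(2))
  then have "phi_gradient k /\<^sub>R norm (phi_gradient k) = \<omega>" using cs(4) assms(4) by simp
  ultimately show thesis by (rule that)
qed

lemma kappa_eqI:
  fixes q :: "real ^ 'n::finite"
  assumes "CARD('n) \<ge> 2" "2 * real CARD('n) - 4 < \<bar>l\<bar>" "\<bar>l\<bar> < 2 * real CARD('n)"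
    and "phi_lift q = l" "phi_gradient q /\<^sub>R norm (phi_gradient q) = \<omega>"
  shows "kappa \<omega> l = abs_torus q"
  unfolding kappa_def
proof (rule the_equality)
  show "abs_torus q \<in> Gamma_surface l \<and> grad_phi (abs_torus q) /\<^sub>R norm (grad_phi (abs_torus q)) = \<omega>"
    using assms by (simp add: Gamma_surface_def phi.abs_eq grad_phi.abs_eq gradient_phi_lift)
next
  fix k assume k: "k \<in> Gamma_surface l \<and> grad_phi k /\<^sub>R norm (grad_phi k) = \<omega>"
  have "\<exists>k'. k = abs_torus k'" by (induct k rule: torus.abs_induct) blast
  then obtain k' where "k = abs_torus k'" ..
  then show "k = abs_torus q"
    using k gauss_map_inj[OF assms(1-3) _ _ assms(4,5), of k']
    by (simp add: Gamma_surface_def phi.abs_eq grad_phi.abs_eq gradient_phi_lift)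
qed

text \<open>The constant is positive only because the curvature and the gradient do not vanish at
  \<open>kappa \<omega> l\<close>. It depends on \<open>\<omega>\<close> but not on the potential, so equal intensities mean equal moduli of the
  Fourier transforms.\<close>

lemma born_amplitude_intensity:
  fixes \<omega> :: "real ^ 'n::finite"
  assumes "CARD('n) \<ge> 2" "2 * real CARD('n) - 4 < \<bar>l\<bar>" "\<bar>l\<bar> < 2 * real CARD('n)"
    and "norm \<omega> = 1"
  obtains C where "C > 0" "\<And>v k. (cmod (born_amplitude l v k \<omega>))\<^sup>2 =
    C * (cmod (fourier v (kappa (- \<omega>) l - k)))\<^sup>2"
proof -
  obtain q where q: "phi_lift q = l" "phi_gradient q /\<^sub>R norm (phi_gradient q) = \<omega>"
    using gauss_map_surj[OF assms] .
  define b where "b = sqrt \<bar>K_curvature \<omega> l\<bar> * norm (grad_phi (kappa \<omega> l))"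
  have "b > 0"
    using kappa_eqI[OF assms(1-3) q] total_curvature_nonzero[OF assms(1-3) q(1)]
      phi_gradient_nonzero[OF assms(1-3) q(1)]
    by (simp add: b_def K_curvature_def curvature_phi.abs_eq grad_phi.abs_eq gradient_phi_lift)
  have "cmod (born_amplitude l v k \<omega>) = sqrt (2 * pi) / b * cmod (fourier v (kappa (- \<omega>) l - k))"
    for v k
    using \<open>b > 0\<close>
    by (simp add: born_amplitude_def Let_def norm_mult norm_divide flip: b_def)
  then show thesis
    using \<open>b > 0\<close> by (intro that[of "(sqrt (2 * pi) / b)\<^sup>2"]) (simp_all only: power_mult_distrib, simp)
qed

section \<open>Momenta reached by the data\<close>

text \<open>The map \<open>(x, p) \<mapsto> (F x, F (x + p), p)\<close> is open at \<open>(k, q - k)\<close>, because its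
  derivative there has a right inverse when \<open>n\<close> and \<open>m\<close> are linearly independent. Slicing the image of a
  neighbourhood at \<open>(l, l, _)\<close> gives the open set of differences.\<close>

lemma level_difference_interior:
  fixes F :: "'a::euclidean_space \<Rightarrow> real"
  assumes cont: "continuous_on UNIV F"
    and dk: "(F has_derivative (\<lambda>h. n \<bullet> h)) (at k)"
    and dq: "(F has_derivative (\<lambda>h. m \<bullet> h)) (at q)"
    and level: "F k = l" "F q = l"
    and indep: "(n \<bullet> m)\<^sup>2 \<noteq> (norm n)\<^sup>2 * (norm m)\<^sup>2"
    and nbhd: "open U" "k \<in> U" "open V" "q \<in> V"
  obtains W where "open W" "W \<noteq> {}"
    and "\<And>p. p \<in> W \<Longrightarrow> \<exists>x\<in>U. x + p \<in> V \<and> F x = l \<and> F (x + p) = l"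
proof -
  define f where "f z = (F (fst z), F (fst z + snd z), snd z)" for z :: "'a \<times> 'a"
  define f' where "f' z = (n \<bullet> fst z, m \<bullet> (fst z + snd z), snd z)" for z :: "'a \<times> 'a"
  define T where "T = {z :: 'a \<times> 'a. fst z \<in> U \<and> fst z + snd z \<in> V}"
  define \<Delta> where "\<Delta> = (n \<bullet> n) * (m \<bullet> m) - (n \<bullet> m)\<^sup>2"
  have \<Delta>: "\<Delta> \<noteq> 0" using indep by (simp add: \<Delta>_def power2_norm_eq_inner)
  \<comment> \<open>\<open>e, e'\<close> is the basis dual to \<open>n, m\<close> in their span, and \<open>\<Delta>\<close> is the Gram determinant.\<close>
  define e where "e = (1 / \<Delta>) *\<^sub>R ((m \<bullet> m) *\<^sub>R n - (n \<bullet> m) *\<^sub>R m)"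
  define e' where "e' = (1 / \<Delta>) *\<^sub>R ((n \<bullet> n) *\<^sub>R m - (n \<bullet> m) *\<^sub>R n)"
  have "n \<bullet> ((m \<bullet> m) *\<^sub>R n - (n \<bullet> m) *\<^sub>R m) = \<Delta>" "m \<bullet> ((m \<bullet> m) *\<^sub>R n - (n \<bullet> m) *\<^sub>R m) = 0"
    "n \<bullet> ((n \<bullet> n) *\<^sub>R m - (n \<bullet> m) *\<^sub>R n) = 0" "m \<bullet> ((n \<bullet> n) *\<^sub>R m - (n \<bullet> m) *\<^sub>R n) = \<Delta>"
    by (simp_all add: inner_diff_right \<Delta>_def power2_eq_square inner_commute[of m n] mult.commute)
  then have dual: "n \<bullet> e = 1" "m \<bullet> e = 0" "n \<bullet> e' = 0" "m \<bullet> e' = 1"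
    using \<Delta> by (simp_all add: e_def e'_def)
  define g where "g y = (fst y *\<^sub>R e + (fst (snd y) - m \<bullet> snd (snd y)) *\<^sub>R e', snd (snd y))"
    for y :: "real \<times> real \<times> 'a"
  have "f (k, q - k) \<in> interior (f ` T)"
  proof (rule sussmann_open_mapping[where S = UNIV and f' = f' and g' = g])
    show "continuous_on UNIV f"
      unfolding f_def
      by (intro continuous_intros continuous_on_compose2[OF cont]) auto
    show "(f has_derivative f') (at (k, q - k))"
    proof -
      have "((\<lambda>z. F (fst z)) has_derivative (\<lambda>h. n \<bullet> fst h)) (at (k, q - k))"
        by (rule has_derivative_compose[where f = fst and f' = fst])
          (auto intro: dk has_derivative_fst has_derivative_ident)
      moreover have "((\<lambda>z. F (fst z + snd z)) has_derivative (\<lambda>h. m \<bullet> (fst h + snd h))) (at (k, q - k))"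
        by (rule has_derivative_compose[where f = "\<lambda>z. fst z + snd z" and f' = "\<lambda>h. fst h + snd h"])
          (auto intro!: derivative_eq_intros dq)
      ultimately show ?thesis
        unfolding f_def[abs_def] f'_def[abs_def]
        by (intro has_derivative_Pair has_derivative_snd has_derivative_ident)
    qed
    show "bounded_linear g"
      unfolding g_def
      by (intro linear_conv_bounded_linear[THEN iffD1] linearI)
        (auto simp: inner_add_right algebra_simps)
    show "f' \<circ> g = id"
      by (auto simp: fun_eq_iff f'_def g_def inner_add_right dual)
    have "open T" unfolding T_def Collect_conj_eq
      using nbhd
      by (intro open_Int; subst vimage_def[symmetric]) (auto intro!: open_vimage continuous_intros)
    then show "(k, q - k) \<in> interior T" using nbhd by (simp add: interior_open T_def)
  qed auto
  then have mem: "(l, l, q - k) \<in> interior (f ` T)" by (simp add: f_def level)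
  define W where "W = (\<lambda>p. (l, l, p)) -` interior (f ` T)"
  have "open W" unfolding W_def by (intro open_vimage) (auto intro!: continuous_intros)
  moreover have "W \<noteq> {}" using mem by (auto simp: W_def)
  moreover have "\<exists>x\<in>U. x + p \<in> V \<and> F x = l \<and> F (x + p) = l" if "p \<in> W" for p
  proof -
    have "(l, l, p) \<in> f ` T" using that interior_subset by (auto simp: W_def)
    then show ?thesis by (auto simp: f_def T_def)
  qed
  ultimately show thesis by (rule that)
qed

text \<open>In dimension at least 2 a unit vector parallel to \<open>n\<close> can be rotated by a small angle towards an
  orthogonal direction. By Cauchy-Schwarz, \<open>(n \<bullet> \<omega>)\<^sup>2 \<noteq> (norm n)\<^sup>2\<close> says that \<open>\<omega>\<close> is not parallel to \<open>n\<close>.\<close>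

lemma unit_vector_not_parallel_nearby:
  fixes \<omega>\<^sub>0 n :: "'a::euclidean_space"
  assumes "DIM('a) \<ge> 2" "norm \<omega>\<^sub>0 = 1" "n \<noteq> 0" "open B" "\<omega>\<^sub>0 \<in> B"
  obtains \<omega> where "\<omega> \<in> B" "norm \<omega> = 1" "(n \<bullet> \<omega>)\<^sup>2 \<noteq> (norm n)\<^sup>2"
proof (cases "(n \<bullet> \<omega>\<^sub>0)\<^sup>2 = (norm n)\<^sup>2")
  case False
  then show thesis using that assms by blast
next
  case True
  obtain y :: 'a where "y \<noteq> 0" "orthogonal \<omega>\<^sub>0 y"
    using orthogonal_to_vector_exists[OF assms(1)] by blast
  define e where "e = y /\<^sub>R norm y"
  have e: "norm e = 1" "\<omega>\<^sub>0 \<bullet> e = 0"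
    using \<open>y \<noteq> 0\<close> \<open>orthogonal \<omega>\<^sub>0 y\<close> by (simp_all add: e_def orthogonal_def)
  have "\<bar>n \<bullet> \<omega>\<^sub>0\<bar> = norm n * norm \<omega>\<^sub>0"
    using arg_cong[OF True, of sqrt] assms(2) by simp
  then have "norm n *\<^sub>R \<omega>\<^sub>0 = n \<or> norm n *\<^sub>R \<omega>\<^sub>0 = - n"
    using norm_cauchy_schwarz_abs_eq[THEN iffD1] assms(2) by fastforce
  then have "n \<bullet> e = 0"
    using e(2) by (metis inner_minus_left inner_scaleR_left mult_zero_right neg_equal_0_iff_equal)
  define c where "c t = cos t *\<^sub>R \<omega>\<^sub>0 + sin t *\<^sub>R e" for t
  have "open (c -` B)" unfolding c_def using assms(4)
    by (intro open_vimage) (auto intro!: continuous_intros)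
  moreover have "0 \<in> c -` B" using assms(5) by (simp add: c_def)
  ultimately obtain r where r: "r > 0" "ball 0 r \<subseteq> c -` B" by (auto elim: openE)
  define t where "t = min (r / 2) 1"
  have t: "0 < t" "t \<le> 1" "t < r" using r(1) by (auto simp: t_def)
  have "t \<in> ball 0 r" using t by simp
  then have "c t \<in> B" using r(2) by blast
  moreover have "(norm (c t))\<^sup>2 = 1"
  proof -
    have "c t \<bullet> c t = (cos t)\<^sup>2 * (\<omega>\<^sub>0 \<bullet> \<omega>\<^sub>0) + (sin t)\<^sup>2 * (e \<bullet> e)"
      using e(2) inner_commute[of e \<omega>\<^sub>0]
      by (simp add: c_def inner_add_left inner_add_right power2_eq_square)
    also have "\<dots> = 1" using e(1) assms(2) by (simp flip: power2_norm_eq_inner)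
    finally show ?thesis by (simp add: power2_norm_eq_inner)
  qed
  then have "norm (c t) = 1" by (simp add: power2_eq_1_iff) (use norm_ge_zero[of "c t"] in linarith)
  moreover have "(n \<bullet> c t)\<^sup>2 \<noteq> (norm n)\<^sup>2"
  proof
    assume "(n \<bullet> c t)\<^sup>2 = (norm n)\<^sup>2"
    then have "(cos t)\<^sup>2 * (norm n)\<^sup>2 = (norm n)\<^sup>2"
      using True \<open>n \<bullet> e = 0\<close> by (simp add: c_def inner_add_right power_mult_distrib)
    then have "(cos t)\<^sup>2 = 1" using assms(3) by simp
    then have "sin t = 0" using sin_cos_squared_add[of t] by simp
    moreover have "sin t > 0" using t pi_gt3 by (intro sin_gt_zero) auto
    ultimately show False by simp
  qed
  ultimately show thesis by (rule that)
qed


section \<open>Fourier transforms of finitely supported potentials\<close>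

lemma inj_lattice_point: "inj lattice_point"
  by (auto simp: inj_def lattice_point_def vec_eq_iff)

lemma finite_lattice_points:
  fixes D :: "(real ^ 'n::finite) set"
  assumes "bounded D"
  shows "finite {x. lattice_point x \<in> D}"
proof -
  obtain b where b: "\<And>y. y \<in> D \<Longrightarrow> norm y \<le> b" using assms by (auto simp: bounded_iff)
  define m where "m = \<lceil>b\<rceil>"
  have "vec_nth ` {x. lattice_point x \<in> D} \<subseteq> PiE UNIV (\<lambda>_. {- m..m})"
  proof (rule image_subsetI)
    fix x :: "int ^ 'n" assume "x \<in> {x. lattice_point x \<in> D}"
    then have "\<bar>lattice_point x $ i\<bar> \<le> b" for i
      using component_le_norm_cart[of "lattice_point x" i] b order_trans by blast
    then have "\<bar>real_of_int (x $ i)\<bar> \<le> b" for i by simp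
    then have "- m \<le> x $ i \<and> x $ i \<le> m" for i
      unfolding m_def by (simp add: abs_le_iff) (smt (verit) le_of_int_ceiling of_int_le_iff of_int_minus)
    then show "vec_nth x \<in> PiE UNIV (\<lambda>_. {- m..m})" by (simp add: PiE_iff)
  qed
  then have "finite (vec_nth ` {x. lattice_point x \<in> D})"
    by (rule finite_subset) (intro finite_PiE; simp)
  then show ?thesis
    by (rule finite_imageD) (auto simp: inj_on_def vec_nth_inject)
qed

lemma fourier_finite_support:
  fixes v :: "int ^ 'n::finite \<Rightarrow> complex"
  assumes "finite S" "\<And>x. v x \<noteq> 0 \<Longrightarrow> x \<in> S"
  shows "fourier v (abs_torus p) = of_real ((2 * pi) powr (- (real CARD('n) / 2))) *
    (\<Sum>x\<in>S. v x * character (lattice_point x) p)"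
proof -
  have "(\<Sum>\<^sub>\<infinity>x. v x * exp (- \<i> * of_real (p \<bullet> lattice_point x))) =
      (\<Sum>\<^sub>\<infinity>x\<in>S. v x * character (lattice_point x) p)"
    using assms(2) by (intro infsum_cong_neutral) (auto simp: character_def)
  then show ?thesis using assms(1) by (simp add: fourier.abs_eq)
qed

lemma fourier_add:
  fixes v v\<^sub>0 :: "int ^ 'n::finite \<Rightarrow> complex"
  assumes "finite S" "\<And>x. v x \<noteq> 0 \<Longrightarrow> x \<in> S" "finite S\<^sub>0" "\<And>x. v\<^sub>0 x \<noteq> 0 \<Longrightarrow> x \<in> S\<^sub>0"
  shows "fourier (\<lambda>x. v x + v\<^sub>0 x) (abs_torus p) = fourier v (abs_torus p) + fourier v\<^sub>0 (abs_torus p)"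
proof -
  have "x \<in> S \<union> S\<^sub>0" if "v x + v\<^sub>0 x \<noteq> 0" for x
    using that assms(2,4) by (cases "v x = 0") auto
  then show ?thesis
    using assms by (simp add: fourier_finite_support[of "S \<union> S\<^sub>0"] sum.distrib algebra_simps)
qed

text \<open>Both differences of intensities, \<open>\<bar>a + g\<bar>\<^sup>2 - \<bar>a\<bar>\<^sup>2\<close> and the same with \<open>b\<close>, equal
  \<open>\<bar>g\<bar>\<^sup>2\<close> plus twice the real part of the interference term.\<close>

lemma equal_interference:
  assumes "(cmod a)\<^sup>2 = (cmod b)\<^sup>2" "(cmod (a + g))\<^sup>2 = (cmod (b + g))\<^sup>2"
  shows "Re ((a - b) * cnj g) = 0"
  using assms unfolding cmod_power2 by (simp add: power2_eq_square algebra_simps)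


section \<open>Uniqueness\<close>

theorem theoremA14:
  fixes l :: real
    and D D\<^sub>0 :: "(real ^ 'n) set"
    and v\<^sub>0 v w :: "int ^ 'n \<Rightarrow> complex"
    and N :: "('n torus \<times> (real ^ 'n)) set"
    and k\<^sub>0 :: "'n torus" and \<omega>\<^sub>0 :: "real ^ 'n"
  assumes "CARD('n) \<ge> 2"
    and "2 * real CARD('n) - 4 < \<bar>l\<bar>" and "\<bar>l\<bar> < 2 * real CARD('n)"
    and "open D\<^sub>0" and "convex D\<^sub>0" and "bounded D\<^sub>0" and "D\<^sub>0 \<inter> range lattice_point \<noteq> {}"
    and "open D" and "convex D" and "bounded D" and "D \<inter> range lattice_point \<noteq> {}"
    and "setdist D D\<^sub>0 > 0"
    and "\<And>x. v\<^sub>0 x \<noteq> 0 \<Longrightarrow> lattice_point x \<in> D\<^sub>0"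
    and "\<exists>x. v\<^sub>0 x \<noteq> 0"
    and "\<And>x. v x \<noteq> 0 \<Longrightarrow> lattice_point x \<in> D"
    and "\<And>x. w x \<noteq> 0 \<Longrightarrow> lattice_point x \<in> D"
    and "openin (top_of_set (Gamma_surface l \<times> sphere 0 1)) N"
    and "(k\<^sub>0, \<omega>\<^sub>0) \<in> N"
    and "\<And>k \<omega>. (k, \<omega>) \<in> N \<Longrightarrow>
           (cmod (born_amplitude l v k \<omega>))\<^sup>2 = (cmod (born_amplitude l w k \<omega>))\<^sup>2"
    and "\<And>k \<omega>. (k, \<omega>) \<in> N \<Longrightarrow>
           (cmod (born_amplitude l (\<lambda>x. v x + v\<^sub>0 x) k \<omega>))\<^sup>2 =
           (cmod (born_amplitude l (\<lambda>x. w x + v\<^sub>0 x) k \<omega>))\<^sup>2"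
  shows "v = w"
proof -
  note range = assms(1-3)
  note supp = assms(13,15,16)
  note born = assms(19,20)
  define S where "S = {x. lattice_point x \<in> D}"
  define S\<^sub>0 where "S\<^sub>0 = {x. lattice_point x \<in> D\<^sub>0}"
  have fin: "finite S" "finite S\<^sub>0"
    unfolding S_def S\<^sub>0_def using assms by (auto intro: finite_lattice_points)
  have disj: "D \<inter> D\<^sub>0 = {}"
  proof (rule ccontr)
    assume "D \<inter> D\<^sub>0 \<noteq> {}"
    then obtain x where "x \<in> D" "x \<in> D\<^sub>0" by auto
    then have "setdist D D\<^sub>0 \<le> dist x x" by (rule setdist_le_dist)
    then show False using \<open>setdist D D\<^sub>0 > 0\<close> by simp
  qed

  obtain T where T: "open T" "N = (Gamma_surface l \<times> sphere 0 1) \<inter> T"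
    using \<open>openin _ N\<close> by (auto simp: openin_open)
  then have "(k\<^sub>0, \<omega>\<^sub>0) \<in> T" "k\<^sub>0 \<in> Gamma_surface l" "norm \<omega>\<^sub>0 = 1"
    using \<open>(k\<^sub>0, \<omega>\<^sub>0) \<in> N\<close> by auto
  then obtain A B where AB: "open A" "open B" "(k\<^sub>0, \<omega>\<^sub>0) \<in> A \<times> B" "A \<times> B \<subseteq> T"
    using T(1) open_prod_elim by metis
  have "\<exists>k. k\<^sub>0 = abs_torus k" by (induct k\<^sub>0 rule: torus.abs_induct) blast
  then obtain k where k: "k\<^sub>0 = abs_torus k" ..
  have level_k: "phi_lift k = l"
    using \<open>k\<^sub>0 \<in> Gamma_surface l\<close> by (simp add: k Gamma_surface_def phi.abs_eq)
  \<comment> \<open>The normals at \<open>k\<close> and at \<open>\<kappa>(-\<omega>\<^sub>0)\<close> may be parallel, hence the change of \<open>\<omega>\<^sub>0\<close>.\<close>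
  obtain \<omega> where \<omega>: "\<omega> \<in> B" "norm \<omega> = 1" "(phi_gradient k \<bullet> \<omega>)\<^sup>2 \<noteq> (norm (phi_gradient k))\<^sup>2"
    using unit_vector_not_parallel_nearby[of \<omega>\<^sub>0 "phi_gradient k" B] range(1) \<open>norm \<omega>\<^sub>0 = 1\<close>
      phi_gradient_nonzero[OF range level_k] AB by auto
  obtain q where q: "phi_lift q = l" "phi_gradient q /\<^sub>R norm (phi_gradient q) = - \<omega>"
    using gauss_map_surj[OF range, of "- \<omega>"] \<omega>(2) by auto
  define r where "r = norm (phi_gradient q)"
  have "r \<noteq> 0" using phi_gradient_nonzero[OF range q(1)] by (simp add: r_def)
  then have "phi_gradient q = r *\<^sub>R (- \<omega>)" by (simp add: r_def flip: q(2))
  then have "(phi_gradient k \<bullet> phi_gradient q)\<^sup>2 = r\<^sup>2 * (phi_gradient k \<bullet> \<omega>)\<^sup>2" by (simp add: power_mult_distrib)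
  then have indep: "(phi_gradient k \<bullet> phi_gradient q)\<^sup>2 \<noteq> (norm (phi_gradient k))\<^sup>2 * (norm (phi_gradient q))\<^sup>2"
    using \<omega>(3) \<open>r \<noteq> 0\<close> by (simp flip: r_def)

  \<comment> \<open>On the surface, a point \<open>q\<close> near the chosen one is \<open>\<kappa>(-\<omega>')\<close> for \<open>\<omega>'\<close> the negative of its
    normal direction; \<open>V\<close> collects the points whose \<open>\<omega>'\<close> lies in \<open>B\<close>, an open condition because the
    Gauss map is continuous.\<close>
  define U where "U = (abs_torus -` A :: (real ^ 'n) set)"
  define V where "V = {q. phi_gradient q \<noteq> 0} \<inter> (\<lambda>q. - (phi_gradient q /\<^sub>R norm (phi_gradient q))) -` B"
  have "open U" using AB(1) by (simp add: U_def open_torus_def)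
  moreover have "open V" unfolding V_def
  proof (rule continuous_open_preimage)
    show "open {q :: real ^ 'n. phi_gradient q \<noteq> 0}"
      by (intro open_Collect_neq continuous_on_phi_gradient continuous_on_const)
    show "continuous_on {q. phi_gradient q \<noteq> 0} (\<lambda>q::real ^ 'n. - (phi_gradient q /\<^sub>R norm (phi_gradient q)))"
      by (intro continuous_intros continuous_on_phi_gradient) auto
  qed (rule AB(2))
  moreover have "k \<in> U" "q \<in> V"
    using AB(3) k q(2) \<omega>(1) phi_gradient_nonzero[OF range q(1)] by (auto simp: U_def V_def)
  moreover have "continuous_on UNIV (phi_lift :: real ^ 'n \<Rightarrow> real)"
    by (meson phi_lift_has_derivative has_derivative_continuous continuous_at_imp_continuous_on)
  ultimately obtain W where W: "open W" "W \<noteq> {}"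
    "\<And>p. p \<in> W \<Longrightarrow> \<exists>x\<in>U. x + p \<in> V \<and> phi_lift x = l \<and> phi_lift (x + p) = l"
    using level_difference_interior[OF _ phi_lift_has_derivative phi_lift_has_derivative
        level_k q(1) indep] by metis

  have re: "Re ((\<Sum>x\<in>S. (v x - w x) * character (lattice_point x) p) *
      cnj (\<Sum>y\<in>S\<^sub>0. v\<^sub>0 y * character (lattice_point y) p)) = 0" if p: "p \<in> W" for p
  proof -
    obtain x where x: "x \<in> U" "x + p \<in> V" "phi_lift x = l" "phi_lift (x + p) = l"
      using W(3)[OF p] by blast
    define \<omega>' where "\<omega>' = - (phi_gradient (x + p) /\<^sub>R norm (phi_gradient (x + p)))"
    have unit: "norm \<omega>' = 1" using phi_gradient_nonzero[OF range x(4)] by (simp add: \<omega>'_def)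
    have inN: "(abs_torus x, \<omega>') \<in> N"
      using x AB(4) unit by (auto simp: T(2) U_def V_def \<omega>'_def[symmetric] Gamma_surface_def phi.abs_eq)
    have "kappa (- \<omega>') l = abs_torus (x + p)"
      using kappa_eqI[OF range x(4)] by (simp add: \<omega>'_def)
    then have diff: "kappa (- \<omega>') l - abs_torus x = abs_torus p"
      by (simp flip: plus_torus.abs_eq)
    obtain C where C: "C > 0" "\<And>u. (cmod (born_amplitude l u (abs_torus x) \<omega>'))\<^sup>2 =
        C * (cmod (fourier u (abs_torus p)))\<^sup>2"
      using born_amplitude_intensity[OF range unit] diff by metis
    define b where "b = (2 * pi) powr (- (real CARD('n) / 2))"
    have "b > 0" by (simp add: b_def)
    have "(cmod (fourier v (abs_torus p)))\<^sup>2 = (cmod (fourier w (abs_torus p)))\<^sup>2"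
      using born(1)[OF inN] C by simp
    moreover have "(cmod (fourier v (abs_torus p) + fourier v\<^sub>0 (abs_torus p)))\<^sup>2 =
        (cmod (fourier w (abs_torus p) + fourier v\<^sub>0 (abs_torus p)))\<^sup>2"
      using born(2)[OF inN] C fourier_add[OF fin(1) _ fin(2), of v v\<^sub>0 p]
        fourier_add[OF fin(1) _ fin(2), of w v\<^sub>0 p] supp
      by (simp add: S_def S\<^sub>0_def)
    ultimately have "Re ((fourier v (abs_torus p) - fourier w (abs_torus p)) *
        cnj (fourier v\<^sub>0 (abs_torus p))) = 0"
      by (rule equal_interference)
    moreover have "fourier v (abs_torus p) = b * (\<Sum>x\<in>S. v x * character (lattice_point x) p)"
      "fourier w (abs_torus p) = b * (\<Sum>x\<in>S. w x * character (lattice_point x) p)"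
      "fourier v\<^sub>0 (abs_torus p) = b * (\<Sum>y\<in>S\<^sub>0. v\<^sub>0 y * character (lattice_point y) p)"
      unfolding b_def using supp fin
      by (auto intro!: fourier_finite_support simp: S_def S\<^sub>0_def)
    moreover have "(b * X - b * Y) * cnj (b * Z) = of_real (b\<^sup>2) * ((X - Y) * cnj Z)" for X Y Z :: complex
      by (simp add: power2_eq_square algebra_simps)
    moreover have "(\<Sum>x\<in>S. (v x - w x) * character (lattice_point x) p) =
        (\<Sum>x\<in>S. v x * character (lattice_point x) p) - (\<Sum>x\<in>S. w x * character (lattice_point x) p)"
      by (simp add: left_diff_distrib sum_subtractf)
    ultimately have "Re (of_real (b\<^sup>2) * ((\<Sum>x\<in>S. (v x - w x) * character (lattice_point x) p) *
        cnj (\<Sum>y\<in>S\<^sub>0. v\<^sub>0 y * character (lattice_point y) p))) = 0"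
      by (simp only:)
    then show ?thesis using \<open>b > 0\<close> by simp
  qed
  obtain y where "y \<in> S\<^sub>0" "v\<^sub>0 y \<noteq> 0" using assms(13,14) by (auto simp: S\<^sub>0_def)
  have "v x - w x = 0" if "x \<in> S" for x
  proof (rule interference_determines[where f = "\<lambda>x. v x - w x" and g = v\<^sub>0 and \<xi> = lattice_point])
    show "inj_on lattice_point S" "inj_on lattice_point S\<^sub>0"
      using inj_lattice_point inj_on_subset by blast+
    show "lattice_point ` S \<subseteq> D" "lattice_point ` S\<^sub>0 \<subseteq> D\<^sub>0" by (auto simp: S_def S\<^sub>0_def)
  qed (fact fin disj W(1,2) re \<open>convex D\<close> \<open>convex D\<^sub>0\<close> \<open>y \<in> S\<^sub>0\<close> \<open>v\<^sub>0 y \<noteq> 0\<close> that)+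
  moreover have "v x = 0" "w x = 0" if "x \<notin> S" for x
    using supp(2,3)[of x] that by (auto simp: S_def)
  ultimately have "v x = w x" for x by (cases "x \<in> S") auto
  then show ?thesis by (rule ext)
qed

end
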